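(* Let $\Omega\subset\mathbb{R}^n$ be a smooth open domain, $1\le k\le n-1$, let $\rho:[0,\infty)\to(0,\infty)$ be a positive function of class $C^1$, and let $A(\omega)=\rho(|\omega|^2)\,\omega$ for $\omega\in\Lambda^k(\Omega)$. Assume that $A$ is invertible, with inverse $B=A^{-1}$. (i) Let $u\in\Lambda^{k-1}(\Omega)$ and $v\in\Lambda^{k+1}(\Omega)$ be conjugate $A$-harmonic forms of class $C^2$, i.e. $A(du)=\delta v$. Then $\tilde\omega:=\delta v=A(du)\in\Lambda^k(\Omega)$ satisfies $$\delta\tilde\omega=0,\qquad d\tilde\omega=\Gamma\wedge\tilde\omega,\qquad\text{with } \Gamma:=d\,\ln\rho\big(|B(\tilde\omega)|^2\big).$$ (ii) Conversely, let $\tilde\omega\in\Lambda^k(\Omega)$ be a form of class $C^1$ such that the function $\rho(|B(\tilde\omega)|^2)$ is of class $C^1$, and suppose that $\delta\tilde\omega=0$ and $d\tilde\omega=\Gamma\wedge\tilde\omega$ with $\Gamma=d\,\ln\rho(|B(\tilde\omega)|^2)$. Then $\omega:=B(\tilde\omega)$ satisfies $$\delta\big(\rho(|\omega|^2)\,\omega\big)=0,\qquad d\omega=0 .$$ (iii) If, in addition to the hypotheses of (ii), $\Omega$ is contractible, then there are conjugate $A$-harmonic forms $u\in\Lambda^{k-1}(\Omega)$ and $v\in\Lambda^{k+1}(\Omega)$ (i.e. $A(du)=\delta v$) such that $\omega=du$ and $\tilde\omega=\delta v$.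
   Context: $\Lambda^k(\Omega)$ denotes the differential $k$-forms on $\Omega$ with the Euclidean metric; $*$ is the Hodge star, $|\omega|^2=*(\omega\wedge *\omega)$, $d$ is the exterior derivative and $\delta$ is its formal adjoint. The operator $A$ acts pointwise (it is of order $0$). $A$ is called invertible if there is a pointwise-acting map $B$ on $k$-forms with $B(A(\omega))=\omega$ and $A(B(\tilde\omega))=\tilde\omega$ for all $k$-forms $\omega,\tilde\omega$. Forms $u\in\Lambda^{k-1}(\Omega)$, $v\in\Lambda^{k+1}(\Omega)$ are called conjugate $A$-harmonic if $A(du)=\delta v$. *)

theory Defs
  imports "HOL-Analysis.Analysis"
begin

text \<open>
  The exterior algebra of the dual of \<open>\<real>\<^sup>n\<close>, \<open>n = CARD('n)\<close>, is represented by its components in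
  the basis \<open>dx\<^sub>I = dx\<^sub>i\<^sub>1 \<and> \<dots> \<and> dx\<^sub>i\<^sub>k\<close> (\<open>I = {i\<^sub>1 < \<dots> < i\<^sub>k}\<close>), one for each set \<open>I\<close> of indices.
  The order on \<open>'n\<close> fixes signs and the orientation \<open>dx\<^sub>1 \<and> \<dots> \<and> dx\<^sub>n\<close>. The Euclidean inner
  product of component vectors makes the \<open>dx\<^sub>I\<close> orthonormal.
  Forms on \<open>\<Omega>\<close> are total functions of which only the values on \<open>\<Omega>\<close> matter.
\<close>

type_synonym 'n covec = "real ^ ('n set)"
type_synonym 'n form = "real ^ 'n \<Rightarrow> real ^ ('n set)"

definition covecs :: "nat \<Rightarrow> ('n::finite) covec set" where
  "covecs k = {a. \<forall>I. card I \<noteq> k \<longrightarrow> a $ I = 0}"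

definition k_form :: "(real ^ ('n::finite)) set \<Rightarrow> nat \<Rightarrow> 'n form \<Rightarrow> bool" where
  "k_form \<Omega> k \<omega> \<longleftrightarrow> (\<forall>x\<in>\<Omega>. \<omega> x \<in> covecs k)"

text \<open>For disjoint \<open>I\<close>, \<open>J\<close>: \<open>dx\<^sub>I \<and> dx\<^sub>J = shuffle_sign I J \<cdot> dx\<^sub>I\<^sub>\<union>\<^sub>J\<close>.\<close>

definition shuffle_sign :: "('n::linorder) set \<Rightarrow> 'n set \<Rightarrow> real" where
  "shuffle_sign I J = (-1) ^ card {(i, j). i \<in> I \<and> j \<in> J \<and> j < i}"

definition wedge :: "('n::{finite,linorder}) covec \<Rightarrow> 'n covec \<Rightarrow> 'n covec"
    (infixr \<open>\<and>\<^sub>w\<close> 70) where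
  "a \<and>\<^sub>w b = (\<chi> K. \<Sum>I\<in>Pow K. shuffle_sign I (K - I) * a $ I * b $ (K - I))"

definition dx :: "'n::finite \<Rightarrow> 'n covec" where
  "dx i = axis {i} 1"

text \<open>\<open>* dx\<^sub>I = shuffle_sign I (- I) \<cdot> dx\<^sub>-\<^sub>I\<close>, so that \<open>dx\<^sub>I \<and> * dx\<^sub>I\<close> is the volume form.\<close>

definition hodge :: "('n::{finite,linorder}) covec \<Rightarrow> 'n covec" where
  "hodge a = (\<chi> J. shuffle_sign (- J) J * a $ (- J))"

text \<open>\<open>|a|\<^sup>2 = *(a \<and> *a)\<close>, read off as the coefficient of the \<open>0\<close>-covector \<open>dx\<^sub>{\<^sub>} = 1\<close>.\<close>

definition form_norm2 :: "('n::{finite,linorder}) covec \<Rightarrow> real" where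
  "form_norm2 a = hodge (a \<and>\<^sub>w hodge a) $ {}"

definition zero_form :: "(real ^ ('n::finite) \<Rightarrow> real) \<Rightarrow> 'n form" where
  "zero_form f = (\<lambda>x. axis {} (f x))"

definition partial :: "'n::finite \<Rightarrow> (real ^ 'n \<Rightarrow> 'b::real_normed_vector) \<Rightarrow> real ^ 'n \<Rightarrow> 'b" where
  "partial i f x = frechet_derivative f (at x) (axis i 1)"

text \<open>Class \<open>C\<^sup>m\<close> on an open set.\<close>

primrec C_on :: "nat \<Rightarrow> (real ^ ('n::finite)) set \<Rightarrow> (real ^ 'n \<Rightarrow> 'b::real_normed_vector) \<Rightarrow> bool" where
  "C_on 0 S f \<longleftrightarrow> continuous_on S f"
| "C_on (Suc m) S f \<longleftrightarrow> (\<forall>x\<in>S. f differentiable at x) \<and> (\<forall>i. C_on m S (partial i f))"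

definition ext_d :: "('n::{finite,linorder}) form \<Rightarrow> 'n form" where
  "ext_d \<omega> = (\<lambda>x. \<Sum>i\<in>UNIV. dx i \<and>\<^sub>w partial i \<omega> x)"

text \<open>
  The formal adjoint of the constant-coefficient operator \<open>\<Sum>\<^sub>i E\<^sub>i \<partial>\<^sub>i\<close>, here with \<open>E\<^sub>i = (dx\<^sub>i \<and> _)\<close>,
  is \<open>- \<Sum>\<^sub>i E\<^sub>i\<^sup>T \<partial>\<^sub>i\<close>; see \<open>codiff_formal_adjoint\<close> below. On \<open>k\<close>-forms this is
  \<open>(-1)\<^bsup>n(k+1)+1\<^esup> * d *\<close>.
\<close>

definition codiff :: "('n::{finite,linorder}) form \<Rightarrow> 'n form" where
  "codiff \<omega> = (\<lambda>x. - (\<Sum>i\<in>UNIV. adjoint (wedge (dx i)) (partial i \<omega> x)))"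

definition smooth_domain :: "(real ^ ('n::finite)) set \<Rightarrow> bool" where
  "smooth_domain \<Omega> \<longleftrightarrow> open \<Omega> \<and> connected \<Omega> \<and> \<Omega> \<noteq> {} \<and>
     (\<forall>p\<in>frontier \<Omega>. \<exists>U (g :: real ^ 'n \<Rightarrow> real). open U \<and> p \<in> U \<and> (\<forall>m. C_on m U g) \<and>
        (\<forall>x\<in>U. \<exists>i. partial i g x \<noteq> 0) \<and> \<Omega> \<inter> U = {x\<in>U. g x < 0})"

definition C1_halfline :: "(real \<Rightarrow> real) \<Rightarrow> bool" where
  "C1_halfline \<rho> \<longleftrightarrow> (\<exists>\<rho>'. continuous_on {0..} \<rho>' \<and>
     (\<forall>t\<in>{0..}. (\<rho> has_real_derivative \<rho>' t) (at t within {0..})))"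

definition A_op :: "(real \<Rightarrow> real) \<Rightarrow> ('n::{finite,linorder}) form \<Rightarrow> 'n form" where
  "A_op \<rho> \<omega> = (\<lambda>x. \<rho> (form_norm2 (\<omega> x)) *\<^sub>R \<omega> x)"

text \<open>
  \<open>B\<close> acts pointwise on \<open>k\<close>-forms, by some fibre map \<open>b x\<close> at each point \<open>x\<close>, and is a two-sided
  inverse of \<open>A\<close>. No regularity is imposed on the \<open>k\<close>-forms here.
\<close>

definition pointwise_inverse ::
    "(real ^ ('n::finite)) set \<Rightarrow> nat \<Rightarrow> ('n form \<Rightarrow> 'n form) \<Rightarrow> ('n form \<Rightarrow> 'n form) \<Rightarrow> bool" where
  "pointwise_inverse \<Omega> k A B \<longleftrightarrow>
     (\<exists>b. \<forall>\<omega>. k_form \<Omega> k \<omega> \<longrightarrow> (\<forall>x\<in>\<Omega>. B \<omega> x = b x (\<omega> x))) \<and>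
     (\<forall>\<omega>. k_form \<Omega> k \<omega> \<longrightarrow>
        k_form \<Omega> k (B \<omega>) \<and> (\<forall>x\<in>\<Omega>. B (A \<omega>) x = \<omega> x) \<and> (\<forall>x\<in>\<Omega>. A (B \<omega>) x = \<omega> x))"

definition conjugate_harmonic ::
    "(real ^ ('n::{finite,linorder})) set \<Rightarrow> ('n form \<Rightarrow> 'n form) \<Rightarrow> 'n form \<Rightarrow> 'n form \<Rightarrow> bool" where
  "conjugate_harmonic \<Omega> A u v \<longleftrightarrow> (\<forall>x\<in>\<Omega>. A (ext_d u) x = codiff v x)"

definition Gamma_form ::
    "(real \<Rightarrow> real) \<Rightarrow> ('n::{finite,linorder} form \<Rightarrow> 'n form) \<Rightarrow> 'n form \<Rightarrow> 'n form" where
  "Gamma_form \<rho> B \<eta> = ext_d (zero_form (\<lambda>x. ln (\<rho> (form_norm2 (B \<eta> x)))))"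

text \<open>The polarisation of \<open>form_norm2\<close> is the component inner product.\<close>

lemma form_inner: "hodge (a \<and>\<^sub>w hodge b) $ {} = a \<bullet> b"
proof -
  have s: "shuffle_sign I J * shuffle_sign I J = 1" for I J :: "'a set"
    by (simp add: shuffle_sign_def flip: power_mult_distrib)
  have e: "shuffle_sign UNIV ({} :: 'a set) = 1"
    by (simp add: shuffle_sign_def)
  have "hodge (a \<and>\<^sub>w hodge b) $ {} =
      (\<Sum>I\<in>UNIV. (shuffle_sign I (- I) * shuffle_sign I (- I)) * (a $ I * b $ I))"
    by (simp add: hodge_def wedge_def e Compl_eq_Diff_UNIV[symmetric] ac_simps del: mult_1)
  then show ?thesis
    by (simp add: s inner_vec_def)
qed

lemma linear_wedge: "linear (wedge a)"
  by (rule linearI)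
    (simp_all add: wedge_def vec_eq_iff algebra_simps sum.distrib sum_distrib_left)

lemma wedge_0: "a \<and>\<^sub>w 0 = 0"
  by (simp add: wedge_def vec_eq_iff)

lemma partial_has_derivative:
  assumes "f differentiable at x"
  shows "((\<lambda>t. f (x + t *\<^sub>R axis i 1)) has_vector_derivative partial i f x) (at 0)"
proof -
  have d: "(f has_derivative frechet_derivative f (at x)) (at x)"
    using assms frechet_derivative_works by blast
  then have l: "linear (frechet_derivative f (at x))"
    by (rule has_derivative_linear)
  have g: "((\<lambda>t. x + t *\<^sub>R axis i 1) has_derivative (\<lambda>t. t *\<^sub>R axis i 1)) (at (0::real))"
    by (auto intro!: derivative_eq_intros)
  have d': "(f has_derivative frechet_derivative f (at x)) (at (x + 0 *\<^sub>R axis i 1))"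
    using d by simp
  show ?thesis
    using diff_chain_at[OF g d'] unfolding has_vector_derivative_def partial_def
    by (simp add: o_def linear_scale[OF l])
qed

lemma integral_partial_zero:
  fixes f :: "real ^ 'n \<Rightarrow> real"
  assumes df: "\<And>x. f differentiable at x" and c: "continuous_on UNIV (partial i f)"
    and K: "compact K" and 0: "\<And>x. x \<notin> K \<Longrightarrow> f x = 0"
  shows "(partial i f has_integral 0) UNIV"
proof -
  define e :: "real ^ 'n" where "e = axis i 1"
  have ne: "norm e = 1" by (simp add: e_def)
  have dt: "((\<lambda>t. f (x + t *\<^sub>R e)) has_real_derivative partial i f (x + t *\<^sub>R e)) (at t)" for x t
  proof -
    have "((\<lambda>s. f ((x + t *\<^sub>R e) + s *\<^sub>R e)) has_real_derivative partial i f (x + t *\<^sub>R e)) (at 0)"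
      using partial_has_derivative[OF df, of "x + t *\<^sub>R e" i]
      by (simp add: e_def has_real_derivative_iff_has_vector_derivative)
    then have "((\<lambda>s. f (x + (s + t) *\<^sub>R e)) has_real_derivative partial i f (x + t *\<^sub>R e)) (at 0)"
      by (simp add: scaleR_add_left add_ac)
    then show ?thesis
      using DERIV_shift[of "\<lambda>t. f (x + t *\<^sub>R e)" _ 0 t] by simp
  qed
  have p0: "partial i f x = 0" if "x \<notin> K" for x
  proof -
    have "(f has_derivative (\<lambda>_. 0)) (at x)"
    proof (rule has_derivative_transform_within_open)
      show "((\<lambda>_. 0) has_derivative (\<lambda>_. 0)) (at x)" by simp
      show "open (- K)" using K compact_imp_closed by blast
    qed (use that 0 in auto)
    then show ?thesis
      by (metis frechet_derivative_at partial_def)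
  qed
  obtain M where M: "\<And>x. \<bar>partial i f x\<bar> \<le> M" "M \<ge> 0"
  proof -
    have "bounded (partial i f ` K)"
      using K c by (meson compact_continuous_image compact_imp_bounded continuous_on_subset subset_UNIV)
    then obtain M where M: "\<And>x. x \<in> K \<Longrightarrow> \<bar>partial i f x\<bar> \<le> M"
      by (auto simp: bounded_iff)
    have "\<bar>partial i f x\<bar> \<le> max M 0" for x
      using M[of x] p0[of x] by (cases "x \<in> K") auto
    then show thesis using that[of "max M 0"] by auto
  qed
  obtain R where R: "K \<subseteq> cball 0 R"
    using compact_imp_bounded[OF K] by (force simp: bounded_iff)
  have cf: "continuous_on UNIV f"
    using df by (simp add: continuous_at_imp_continuous_on differentiable_imp_continuous_within)
  have intf: "integrable lborel f"
  proof -
    have "f = (\<lambda>x. indicator K x *\<^sub>R f x)"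
      using 0 by (force simp: indicator_def fun_eq_iff)
    then show ?thesis
      using borel_integrable_compact[OF K continuous_on_subset[OF cf subset_UNIV]] by simp
  qed
  have mf: "f \<in> borel_measurable lborel" using intf by (rule borel_measurable_integrable)
  have mp: "partial i f \<in> borel_measurable lborel"
    using borel_measurable_continuous_onI[OF c] by simp
  define s where "s = (\<lambda>n x. (f ((1 / Suc n) *\<^sub>R e + x) - f x) * Suc n)"
  have trans: "integrable lborel (\<lambda>x. f (c + x))" "(\<integral>x. f (c + x) \<partial>lborel) = (\<integral>x. f x \<partial>lborel)" for c
  proof -
    have *: "(+) c \<in> measurable lborel borel" by simp
    have **: "f \<in> borel_measurable borel" using mf by simp
    show "integrable lborel (\<lambda>x. f (c + x))"
      using integrable_distr[OF *, of f] intf by (simp add: lborel_distr_plus)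
    show "(\<integral>x. f (c + x) \<partial>lborel) = (\<integral>x. f x \<partial>lborel)"
      using integral_distr[OF * **] by (simp add: lborel_distr_plus)
  qed
  have s0: "integral\<^sup>L lborel (s n) = 0" and si: "integrable lborel (s n)" for n
    using trans intf by (simp_all add: s_def)
  have lim: "(\<lambda>n. s n x) \<longlonglongrightarrow> partial i f x" for x
  proof -
    have "((\<lambda>h. (f (x + h *\<^sub>R e) - f x) / h) \<longlongrightarrow> partial i f x) (at 0)"
      using dt[of x 0] by (simp add: DERIV_def)
    moreover have "filterlim (\<lambda>n. 1 / real (Suc n)) (at 0) sequentially"
      using LIMSEQ_Suc[OF lim_1_over_n] by (auto simp: filterlim_at)
    ultimately have "(\<lambda>n. (f (x + (1 / real (Suc n)) *\<^sub>R e) - f x) / (1 / real (Suc n))) \<longlonglongrightarrow> partial i f x"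
      by (rule filterlim_compose)
    then show ?thesis by (simp add: s_def add_ac)
  qed
  have bd: "norm (s n x) \<le> indicator (cball 0 (R + 1)) x *\<^sub>R M" for n x
  proof (cases "x \<in> cball 0 (R + 1)")
    case True
    define h where "h = 1 / real (Suc n)"
    have h: "h > 0" by (simp add: h_def)
    obtain z where "f (x + h *\<^sub>R e) - f (x + 0 *\<^sub>R e) = (h - 0) * partial i f (x + z *\<^sub>R e)"
      using MVT2[OF h, of "\<lambda>t. f (x + t *\<^sub>R e)" "\<lambda>t. partial i f (x + t *\<^sub>R e)"] dt by blast
    then have "s n x = partial i f (x + z *\<^sub>R e)"
      by (simp add: s_def h_def[symmetric] add_ac) (simp add: h_def)
    then show ?thesis using True M by simp
  next
    case False
    have 1: "norm ((1 / Suc n) *\<^sub>R e) \<le> 1" by (simp add: ne)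
    have "norm x \<le> norm ((1 / Suc n) *\<^sub>R e + x) + norm ((1 / Suc n) *\<^sub>R e)"
      using norm_triangle_ineq4[of "(1 / Suc n) *\<^sub>R e + x" "(1 / Suc n) *\<^sub>R e"] by simp
    then have "x \<notin> cball 0 R" "(1 / Suc n) *\<^sub>R e + x \<notin> cball 0 R"
      using False 1 unfolding mem_cball dist_0_norm by linarith+
    then have "x \<notin> K" "(1 / Suc n) *\<^sub>R e + x \<notin> K" using R by auto
    then show ?thesis using 0 False by (simp add: s_def)
  qed
  have iM: "integrable lborel (\<lambda>x. indicator (cball 0 (R + 1)) x *\<^sub>R M :: real)"
    by (rule borel_integrable_compact) auto
  have m: "s n \<in> borel_measurable lborel" for n
    using si borel_measurable_integrable by blast
  have "integrable lborel (partial i f)"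
    by (rule integrable_dominated_convergence[OF mp, of s, OF m iM]) (use lim bd in auto)
  moreover have "(\<lambda>n. integral\<^sup>L lborel (s n)) \<longlonglongrightarrow> integral\<^sup>L lborel (partial i f)"
    by (rule integral_dominated_convergence[OF mp, of s, OF m iM]) (use lim bd in auto)
  then have "integral\<^sup>L lborel (partial i f) = 0"
    using LIMSEQ_unique by (auto simp: s0)
  ultimately show ?thesis
    using has_integral_integral_lborel by metis
qed

text \<open>\<open>\<integral>\<langle>d\<alpha>, \<beta>\<rangle> = \<integral>\<langle>\<alpha>, \<delta>\<beta>\<rangle>\<close> for \<open>\<alpha>\<close> compactly supported in \<open>\<Omega>\<close>.\<close>

lemma codiff_formal_adjoint:
  fixes \<alpha> \<beta> :: "('n::{finite,linorder}) form"
  assumes "open \<Omega>" and \<alpha>: "C_on 1 \<Omega> \<alpha>" and \<beta>: "C_on 1 \<Omega> \<beta>"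
    and K: "compact K" "K \<subseteq> \<Omega>" and 0: "\<And>x. x \<notin> K \<Longrightarrow> \<alpha> x = 0"
  shows "integral \<Omega> (\<lambda>x. ext_d \<alpha> x \<bullet> \<beta> x) = integral \<Omega> (\<lambda>x. \<alpha> x \<bullet> codiff \<beta> x)"
proof -
  define f where "f = (\<lambda>i x. (dx i \<and>\<^sub>w \<alpha> x) \<bullet> \<beta> x)"
  define f' where "f' = (\<lambda>i x. (dx i \<and>\<^sub>w \<alpha> x) \<bullet> partial i \<beta> x + (dx i \<and>\<^sub>w partial i \<alpha> x) \<bullet> \<beta> x)"
  have oK: "open (- K)" using K compact_imp_closed by blast
  have bl: "bounded_linear (wedge a)" for a :: "'n covec"
    using linear_wedge linear_conv_bounded_linear by blast
  have ca: "continuous_on \<Omega> \<alpha>" "continuous_on \<Omega> \<beta>"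
    using \<alpha> \<beta> \<open>open \<Omega>\<close>
    by (auto simp: continuous_on_eq_continuous_at dest: differentiable_imp_continuous_within)
  have cp: "continuous_on \<Omega> (partial i \<alpha>)" "continuous_on \<Omega> (partial i \<beta>)" for i
    using \<alpha> \<beta> by auto
  have d0: "(\<alpha> has_derivative (\<lambda>_. 0)) (at x)" if "x \<notin> K" for x
    by (rule has_derivative_transform_within_open[OF has_derivative_const oK])
      (use that 0 in auto)
  have f0: "f i x = 0" if "x \<notin> K" for i x
    using that 0 by (simp add: f_def wedge_0)
  have df0: "(f i has_derivative (\<lambda>_. 0)) (at x)" if "x \<notin> K" for i x
    by (rule has_derivative_transform_within_open[OF has_derivative_const oK])
      (use that f0 in auto)
  have p0: "partial i \<alpha> x = 0" if "x \<notin> K" for i x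
    using d0[OF that] by (metis frechet_derivative_at partial_def)
  have f'0: "f' i x = 0" if "x \<notin> K" for i x
    using that 0 p0 by (simp add: f'_def wedge_0)
  have df: "(f i has_derivative (\<lambda>v. (dx i \<and>\<^sub>w \<alpha> x) \<bullet> frechet_derivative \<beta> (at x) v
      + (dx i \<and>\<^sub>w frechet_derivative \<alpha> (at x) v) \<bullet> \<beta> x)) (at x)" if "x \<in> \<Omega>" for i x
  proof -
    have a: "(\<alpha> has_derivative frechet_derivative \<alpha> (at x)) (at x)"
      and b: "(\<beta> has_derivative frechet_derivative \<beta> (at x)) (at x)"
      using \<alpha> \<beta> that by (auto simp flip: frechet_derivative_works)
    show ?thesis
      unfolding f_def by (rule has_derivative_inner[OF bounded_linear.has_derivative[OF bl a] b])
  qed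
  have diff: "f i differentiable at x" for i x
    using df[of x i] df0[of x i] K(2) unfolding differentiable_def by blast
  have pf: "partial i (f i) = f' i" for i
  proof
    fix x show "partial i (f i) x = f' i x"
    proof (cases "x \<in> \<Omega>")
      case True
      show ?thesis
        unfolding partial_def frechet_derivative_at[OF df[OF True], symmetric]
        by (simp add: f'_def partial_def)
    next
      case False
      then have "x \<notin> K" using K by auto
      then show ?thesis
        using df0[of x i] f'0 by (metis frechet_derivative_at partial_def)
    qed
  qed
  have cf': "continuous_on UNIV (f' i)" for i
  proof -
    have "continuous_on \<Omega> (f' i)"
      unfolding f'_def
      by (intro continuous_intros bounded_linear.continuous_on[OF bl] ca cp)
    moreover have "continuous_on (- K) (f' i)"
      by (rule continuous_on_eq[OF continuous_on_const[of _ 0]]) (simp add: f'0)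
    ultimately have "continuous_on (\<Omega> \<union> - K) (f' i)"
      using \<open>open \<Omega>\<close> oK by (simp add: continuous_on_open_Un)
    then show ?thesis by (rule continuous_on_subset) (use K(2) in auto)
  qed
  have "(f' i has_integral 0) UNIV" for i
    using integral_partial_zero[of "f i" i K] diff pf cf' K f0 by metis
  then have "((\<lambda>x. \<Sum>i\<in>UNIV. f' i x) has_integral (\<Sum>i\<in>(UNIV::'n set). 0)) UNIV"
    by (intro has_integral_sum) auto
  moreover have "(\<Sum>i\<in>UNIV. f' i x) = ext_d \<alpha> x \<bullet> \<beta> x - \<alpha> x \<bullet> codiff \<beta> x" for x
    by (simp add: f'_def ext_d_def codiff_def inner_sum_left inner_sum_right sum.distrib
        adjoint_works[OF linear_wedge])
  ultimately have I: "((\<lambda>x. ext_d \<alpha> x \<bullet> \<beta> x - \<alpha> x \<bullet> codiff \<beta> x) has_integral 0) UNIV"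
    by simp
  have z: "ext_d \<alpha> x = 0" if "x \<notin> K" for x
    using p0[OF that] by (simp add: ext_d_def wedge_0)
  have ce: "continuous_on \<Omega> (ext_d \<alpha>)"
    unfolding ext_d_def by (intro continuous_intros bounded_linear.continuous_on[OF bl] cp)
  have "(\<lambda>x. ext_d \<alpha> x \<bullet> \<beta> x) = (\<lambda>x. indicator K x *\<^sub>R (ext_d \<alpha> x \<bullet> \<beta> x))"
    using z by (force simp: indicator_def fun_eq_iff)
  moreover have "integrable lborel (\<lambda>x. indicator K x *\<^sub>R (ext_d \<alpha> x \<bullet> \<beta> x))"
    by (intro borel_integrable_compact K continuous_intros continuous_on_subset[OF ce K(2)]
        continuous_on_subset[OF ca(2) K(2)])
  ultimately have 1: "(\<lambda>x. ext_d \<alpha> x \<bullet> \<beta> x) integrable_on UNIV"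
    using integrable_on_lborel by metis
  have 2: "(\<lambda>x. \<alpha> x \<bullet> codiff \<beta> x) integrable_on UNIV"
    using integrable_diff[OF 1 has_integral_integrable[OF I]] by simp
  have eq: "integral UNIV (\<lambda>x. ext_d \<alpha> x \<bullet> \<beta> x) = integral UNIV (\<lambda>x. \<alpha> x \<bullet> codiff \<beta> x)"
    using integral_diff[OF 1 2] integral_unique[OF I] by simp
  have res: "integral \<Omega> g = integral UNIV g" if "\<And>x. x \<notin> K \<Longrightarrow> g x = 0"
    for g :: "_ \<Rightarrow> real"
  proof -
    have "(\<lambda>x. if x \<in> \<Omega> then g x else 0) = g" using that K(2) by (force simp: fun_eq_iff)
    then show ?thesis using integral_restrict_UNIV[of \<Omega> g] by simp
  qed
  show ?thesis
    using eq by (subst (1 2) res) (use z 0 in auto)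
qed

end

(*
  Parts (i) and (ii): write \<eta> = g \<omega> with g = \<rho>(|\<omega>|^2). Then d\<eta> - d(ln g) \<and> \<eta> = g d\<omega>, so the equation for
  \<eta> says exactly that \<omega> = B(\<eta>) is closed; the rest is dd = 0 and \<delta>\<delta> = 0.

  Part (iii) is the Poincare lemma on a contractible open set, applied to B(\<eta>) and, by duality, to
  \<eta>. A contraction is only continuous. It is replaced by a C^2 map H : \<Omega> x R \<rightarrow> \<Omega> which is
  constant for t \<le> -1 and the identity for t \<ge> 2: H is a countable convex combination of local
  choices with C^2 bump functions as weights, kept inside \<Omega> by convexity of small balls. For closed
  \<omega>, the pullback H*\<omega> = \<alpha> + dt \<and> \<kappa> is closed, i.e. \<partial>_t \<alpha> = d_x \<kappa>, so that the integral of \<kappa> over t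
  is a primitive of \<omega>. Since H is C^2 and \<omega> is C^1, this primitive is C^1.
*)

theory Submission
  imports Defs
begin

subsection \<open>Functions of class C^m on a Euclidean space\<close>

text \<open>Regularity is the obstacle. In (ii) the map \<open>B\<close> acts pointwise and has no
  regularity of its own; \<open>B \<eta>\<close> is C^1 only because it is \<open>\<eta>\<close>
  divided by the positive function \<open>\<rho> (form_norm2 (B \<eta> x))\<close>, which is C^1 by
  hypothesis. The closed form fed to the Poincare lemma is therefore merely C^1, and closedness of
  its pullback has to be proved without differentiating it twice: the second derivatives that must
  cancel all fall on H, which is why H is taken C^2. Finite order is enough, so the bumps are powers
  of \<open>max 0 s\<close>. The pullback of a basis form is a product of operators
  \<open>cyl_step\<close>, one for each index. They anticommute as the operators
  \<open>wedge (dx i)\<close> do, so a product can be sorted at the cost of a shuffle sign, and this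
  sign is the one in the coefficients of \<open>ext_d\<close>.\<close>

definition dirD :: "'a \<Rightarrow> ('a::real_normed_vector \<Rightarrow> 'b::real_normed_vector) \<Rightarrow> 'a \<Rightarrow> 'b" where
  "dirD v f x = frechet_derivative f (at x) v"

lemma dirD_eq: "(f has_derivative f') (at x) \<Longrightarrow> dirD v f x = f' v"
  unfolding dirD_def by (metis frechet_derivative_at)

lemma dirD_const: "dirD v (\<lambda>_. c) x = 0"
  by (rule dirD_eq) simp

lemma dirD_works: "f differentiable at x \<Longrightarrow> (f has_derivative (\<lambda>v. dirD v f x)) (at x)"
  unfolding dirD_def by (simp add: frechet_derivative_works[symmetric])

lemma has_derivative_cong_open:
  assumes "open S" "x \<in> S" "\<And>y. y \<in> S \<Longrightarrow> f y = g y"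
  shows "(f has_derivative f') (at x) \<longleftrightarrow> (g has_derivative f') (at x)"
  using has_derivative_transform_within_open[OF _ assms(1,2)] assms(3) by metis

lemma dirD_cong:
  assumes "open S" "x \<in> S" "\<And>y. y \<in> S \<Longrightarrow> f y = g y"
  shows "dirD v f x = dirD v g x"
  using has_derivative_cong_open[OF assms] unfolding dirD_def frechet_derivative_def by presburger

lemma differentiable_cong_open:
  assumes "open S" "x \<in> S" "\<And>y. y \<in> S \<Longrightarrow> f y = g y"
  shows "f differentiable at x \<longleftrightarrow> g differentiable at x"
  using has_derivative_cong_open[OF assms] unfolding differentiable_def by presburger

lemma partial_eq_dirD: "partial i f = dirD (axis i 1) f"
  by (simp add: partial_def dirD_def fun_eq_iff)

text \<open>This extends \<open>C_on\<close> to arbitrary Euclidean spaces: the homotopy lives on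
  pairs \<open>(x, t)\<close>, a type that is not of the form \<open>real ^ 'n\<close>, and the
  bumps are built from functions of one real variable.\<close>

primrec Ck :: "nat \<Rightarrow> 'a::euclidean_space set \<Rightarrow> ('a \<Rightarrow> 'b::real_normed_vector) \<Rightarrow> bool" where
  "Ck 0 S f \<longleftrightarrow> continuous_on S f"
| "Ck (Suc m) S f \<longleftrightarrow> (\<forall>x\<in>S. f differentiable at x) \<and> (\<forall>b\<in>Basis. Ck m S (dirD b f))"

lemma C_on_eq_Ck: "C_on m S f \<longleftrightarrow> Ck m S f"
  by (induction m arbitrary: f) (simp_all add: partial_eq_dirD Basis_vec_def)

lemma Ck_cong:
  assumes "open S" "\<And>x. x \<in> S \<Longrightarrow> f x = g x"
  shows "Ck m S f \<longleftrightarrow> Ck m S g"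
  using assms(2)
proof (induction m arbitrary: f g)
  case 0
  then show ?case by (simp cong: continuous_on_cong)
next
  case (Suc m)
  have "Ck m S (dirD b f) \<longleftrightarrow> Ck m S (dirD b g)" for b
    by (rule Suc.IH) (rule dirD_cong[OF assms(1)], use Suc.prems in auto)
  moreover have "f differentiable at x \<longleftrightarrow> g differentiable at x" if "x \<in> S" for x
    by (rule differentiable_cong_open[OF assms(1) that]) (use Suc.prems in auto)
  ultimately show ?case by auto
qed

text \<open>The working criterion for class C^m: on an open set any explicit derivative formula may
  stand for the choice made by \<open>frechet_derivative\<close>.\<close>

lemma Ck_SucI:
  assumes "open S" and "\<And>x. x \<in> S \<Longrightarrow> (f has_derivative f' x) (at x)"
    and "\<And>b. b \<in> Basis \<Longrightarrow> Ck m S (\<lambda>x. f' x b)"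
  shows "Ck (Suc m) S f"
proof -
  have "Ck m S (dirD b f) \<longleftrightarrow> Ck m S (\<lambda>x. f' x b)" for b
    by (intro Ck_cong assms(1) dirD_eq assms(2))
  then show ?thesis using assms(2,3) by (auto simp: differentiable_def)
qed

lemma Ck_SucD:
  assumes "Ck (Suc m) S f"
  shows "x \<in> S \<Longrightarrow> f differentiable at x" "b \<in> Basis \<Longrightarrow> Ck m S (dirD b f)"
  using assms by auto

lemma Ck_imp_continuous_on: "Ck m S f \<Longrightarrow> continuous_on S f"
  by (cases m) (auto intro: continuous_at_imp_continuous_on differentiable_imp_continuous_within)

lemma Ck_Suc_imp: "Ck (Suc m) S f \<Longrightarrow> Ck m S f"
proof (induction m arbitrary: f)
  case 0
  then show ?case using Ck_imp_continuous_on[OF 0] by simp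
qed auto

lemma Ck_mono: "l \<le> m \<Longrightarrow> Ck m S f \<Longrightarrow> Ck l S f"
  by (induction rule: dec_induct) (blast dest: Ck_Suc_imp)+

lemma Ck_subset: "Ck m S f \<Longrightarrow> T \<subseteq> S \<Longrightarrow> Ck m T f"
  by (induction m arbitrary: f) (auto intro: continuous_on_subset)

lemma Ck_const: "Ck m S (\<lambda>_. c)"
proof (induction m arbitrary: c)
  case (Suc m)
  have "dirD b (\<lambda>_::'a. c) = (\<lambda>_. 0)" for b
    by (rule ext, rule dirD_eq) simp
  then show ?case using Suc by simp
qed simp

lemma Ck_linear:
  assumes L: "bounded_linear L" shows "Ck m UNIV L"
proof (cases m)
  case 0
  then show ?thesis using L linear_continuous_on by auto
next
  case (Suc l)
  show ?thesis
    unfolding Suc by (rule Ck_SucI[where f' = "\<lambda>_. L"]) (auto simp: L bounded_linear_imp_has_derivative Ck_const)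
qed

lemma Ck_linear_comp:
  assumes L: "bounded_linear L" and "open S" and "Ck m S f"
  shows "Ck m S (\<lambda>x. L (f x))"
  using assms(3)
proof (induction m arbitrary: f)
  case 0
  then show ?case using bounded_linear.continuous_on[OF L] by auto
next
  case (Suc m)
  have d: "((\<lambda>x. L (f x)) has_derivative (\<lambda>v. L (dirD v f x))) (at x)" if "x \<in> S" for x
    using Suc.prems that by (intro bounded_linear.has_derivative[OF L] dirD_works) auto
  show ?case
    using Suc by (intro Ck_SucI[OF assms(2) d]) auto
qed

lemma Ck_add:
  assumes "open S" and "Ck m S f" "Ck m S g"
  shows "Ck m S (\<lambda>x. f x + g x)"
  using assms(2,3)
proof (induction m arbitrary: f g)
  case 0
  then show ?case by (auto intro: continuous_intros)
next
  case (Suc m)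
  have d: "((\<lambda>x. f x + g x) has_derivative (\<lambda>v. dirD v f x + dirD v g x)) (at x)" if "x \<in> S" for x
    using Suc.prems that by (intro has_derivative_add dirD_works) auto
  show ?case
    using Suc by (intro Ck_SucI[OF assms(1) d]) auto
qed

lemma Ck_sum:
  assumes "open S" and "\<And>i. i \<in> I \<Longrightarrow> Ck m S (f i)"
  shows "Ck m S (\<lambda>x. \<Sum>i\<in>I. f i x)"
  using assms(2)
  by (induction I rule: infinite_finite_induct) (auto intro: Ck_const Ck_add[OF assms(1)])

lemma Ck_bilinear:
  assumes L: "bounded_bilinear prd" and "open S" and "Ck m S f" "Ck m S g"
  shows "Ck m S (\<lambda>x. prd (f x) (g x))"
  using assms(3,4)
proof (induction m arbitrary: f g)
  case 0
  then show ?case using bounded_bilinear.continuous_on[OF L] by auto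
next
  case (Suc m)
  have d: "((\<lambda>x. prd (f x) (g x)) has_derivative (\<lambda>v. prd (f x) (dirD v g x) + prd (dirD v f x) (g x))) (at x)"
    if "x \<in> S" for x
    using Suc.prems that by (intro bounded_bilinear.FDERIV[OF L] dirD_works) auto
  have "Ck m S f" "Ck m S g" using Suc.prems Ck_Suc_imp by blast+
  then show ?case
    using Suc by (intro Ck_SucI[OF assms(2) d] Ck_add[OF assms(2)]) auto
qed

lemma dirD_linear:
  assumes "f differentiable at x"
  shows "linear (\<lambda>v. dirD v f x)"
  using dirD_works[OF assms] has_derivative_linear by blast

lemma dirD_expand:
  fixes f :: "'a::euclidean_space \<Rightarrow> 'b::real_normed_vector"
  assumes "f differentiable at x"
  shows "dirD v f x = (\<Sum>b\<in>Basis. (v \<bullet> b) *\<^sub>R dirD b f x)"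
proof -
  have "dirD v f x = dirD (\<Sum>b\<in>Basis. (v \<bullet> b) *\<^sub>R b) f x"
    by (simp add: euclidean_representation)
  also have "\<dots> = (\<Sum>b\<in>Basis. (v \<bullet> b) *\<^sub>R dirD b f x)"
    by (simp add: linear_sum[OF dirD_linear[OF assms]] linear_scale[OF dirD_linear[OF assms]])
  finally show ?thesis .
qed

lemma dirD_compose:
  assumes "f differentiable at x" "g differentiable at (f x)"
  shows "((\<lambda>x. g (f x)) has_derivative (\<lambda>v. dirD (dirD v f x) g (f x))) (at x)"
  using diff_chain_at[OF dirD_works[OF assms(1)] dirD_works[OF assms(2)]] by (simp add: o_def)

text \<open>In coordinates the chain rule is a sum of products of derivatives of \<open>f\<close>
  with derivatives of \<open>g\<close> composed with the same \<open>f\<close>. The induction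
  therefore keeps \<open>f\<close> fixed and varies \<open>g\<close>.\<close>

lemma Ck_compose:
  fixes f :: "'a::euclidean_space \<Rightarrow> 'c::euclidean_space"
  assumes "open S" and "f ` S \<subseteq> T" and "Ck m S f" "Ck m T g"
  shows "Ck m S (\<lambda>x. g (f x))"
  using assms(3,4)
proof (induction m arbitrary: g)
  case 0
  then show ?case using continuous_on_compose2[of T g S f] assms(2) by simp
next
  case (Suc m)
  have f: "f differentiable at x" and g: "g differentiable at (f x)" if "x \<in> S" for x
    using Ck_SucD(1)[OF Suc.prems(1) that] Ck_SucD(1)[OF Suc.prems(2), of "f x"] that assms(2) by auto
  have d: "((\<lambda>x. g (f x)) has_derivative (\<lambda>v. \<Sum>c\<in>Basis. (dirD v f x \<bullet> c) *\<^sub>R dirD c g (f x))) (at x)"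
    if "x \<in> S" for x
    using dirD_compose[OF f g, OF that that] unfolding dirD_expand[OF g[OF that], of "dirD v f x" for v] .
  show ?case
  proof (rule Ck_SucI[OF assms(1) d])
    fix b :: 'a assume b: "b \<in> Basis"
    have "Ck m S (\<lambda>x. dirD b f x \<bullet> c)" for c
      using Suc.prems b by (intro Ck_linear_comp[OF bounded_linear_inner_left assms(1)]) auto
    moreover have "Ck m S (\<lambda>x. dirD c g (f x))" if "c \<in> Basis" for c
      using Suc.IH[OF Ck_Suc_imp[OF Suc.prems(1)] Ck_SucD(2)[OF Suc.prems(2) that]] .
    ultimately show "Ck m S (\<lambda>x. \<Sum>c\<in>Basis. (dirD b f x \<bullet> c) *\<^sub>R dirD c g (f x))"
      by (intro Ck_sum[OF assms(1)] Ck_bilinear[OF bounded_bilinear_scaleR assms(1)])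
  qed
qed

lemma Ck_Suc_realI:
  fixes f :: "real \<Rightarrow> real"
  assumes "open S" and "\<And>x. x \<in> S \<Longrightarrow> (f has_real_derivative f' x) (at x)" and "Ck m S f'"
  shows "Ck (Suc m) S f"
  using assms(3) by (intro Ck_SucI[OF assms(1) assms(2)[unfolded has_field_derivative_def]]) auto

lemma Ck_inverse: "Ck m {x. x \<noteq> 0} (inverse :: real \<Rightarrow> real)"
proof (induction m)
  case 0
  then show ?case by (auto intro: continuous_intros)
next
  case (Suc m)
  have o: "open {x::real. x \<noteq> 0}" by (rule open_Collect_neq) (auto intro: continuous_intros)
  have d: "(inverse has_real_derivative - (inverse x * inverse x)) (at x)" if "x \<noteq> 0" for x :: real
    \<comment> \<open>Writing the derivative as a product of inverses lets the induction hypothesis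
      apply to both factors.\<close>
    using DERIV_inverse[OF that] by (simp add: power2_eq_square)
  show ?case
    using Ck_linear_comp[OF bounded_linear_minus[OF bounded_linear_ident] o
        Ck_bilinear[OF bounded_bilinear_mult o Suc Suc]]
    by (intro Ck_Suc_realI[OF o d]) auto
qed

text \<open>Both mixed derivatives are limits of the second difference quotient
  \<open>(f (x+hu+hv) - f (x+hu) - f (x+hv) + f x) / h\<^sup>2\<close>.\<close>

lemma second_difference_mvt:
  fixes f :: "'a::real_normed_vector \<Rightarrow> real"
  assumes h: "0 < h"
    and d1: "\<And>s t. \<lbrakk>0 \<le> s; s \<le> h; 0 \<le> t; t \<le> h\<rbrakk> \<Longrightarrow> f differentiable at (x + s *\<^sub>R u + t *\<^sub>R v)"
    and d2: "\<And>s t. \<lbrakk>0 \<le> s; s \<le> h; 0 \<le> t; t \<le> h\<rbrakk> \<Longrightarrow> dirD u f differentiable at (x + s *\<^sub>R u + t *\<^sub>R v)"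
  obtains s t where "0 \<le> s" "s \<le> h" "0 \<le> t" "t \<le> h"
    "f (x + h *\<^sub>R u + h *\<^sub>R v) - f (x + h *\<^sub>R u) - f (x + h *\<^sub>R v) + f x
      = h\<^sup>2 * dirD v (dirD u f) (x + s *\<^sub>R u + t *\<^sub>R v)"
proof -
  have line: "((\<lambda>s. g (y + s *\<^sub>R w)) has_real_derivative dirD w g (y + s *\<^sub>R w)) (at s)"
    if "g differentiable at (y + s *\<^sub>R w)" for g :: "'a \<Rightarrow> real" and y w s
  proof -
    have "((\<lambda>s. y + s *\<^sub>R w) has_derivative (\<lambda>t. t *\<^sub>R w)) (at s)"
      by (auto intro!: derivative_eq_intros)
    from diff_chain_at[OF this dirD_works[OF that]]
    have "((\<lambda>s. g (y + s *\<^sub>R w)) has_derivative (\<lambda>t. t * dirD w g (y + s *\<^sub>R w))) (at s)"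
      by (simp add: o_def linear_scale[OF dirD_linear[OF that]])
    then show ?thesis
      by (simp add: has_field_derivative_def mult_commute_abs)
  qed
  \<comment> \<open>The second difference is the increment of \<open>\<phi>\<close> over
    \<open>[0, h]\<close>. The mean value theorem in the \<open>u\<close> direction, followed by one
    in the \<open>v\<close> direction, turns it into a mixed derivative.\<close>
  define \<phi> where "\<phi> = (\<lambda>s. f ((x + h *\<^sub>R v) + s *\<^sub>R u) - f (x + s *\<^sub>R u))"
  define \<phi>' where "\<phi>' = (\<lambda>s. dirD u f ((x + h *\<^sub>R v) + s *\<^sub>R u) - dirD u f (x + s *\<^sub>R u))"
  have p: "(\<phi> has_real_derivative \<phi>' s) (at s)" if "0 \<le> s" "s \<le> h" for s
    unfolding \<phi>_def \<phi>'_def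
    using that h d1[of s h] d1[of s 0] by (intro DERIV_diff line) (auto simp: algebra_simps)
  obtain s where s: "0 < s" "s < h" "\<phi> h - \<phi> 0 = (h - 0) * \<phi>' s"
    using MVT2[OF h, of \<phi> \<phi>'] p by blast
  have "((\<lambda>t. dirD u f ((x + s *\<^sub>R u) + t *\<^sub>R v)) has_real_derivative
      dirD v (dirD u f) ((x + s *\<^sub>R u) + t *\<^sub>R v)) (at t)" if "0 \<le> t" "t \<le> h" for t
    using d2[of s t] s that by (intro line) auto
  then obtain t where t: "0 < t" "t < h"
    "dirD u f ((x + s *\<^sub>R u) + h *\<^sub>R v) - dirD u f ((x + s *\<^sub>R u) + 0 *\<^sub>R v)
      = (h - 0) * dirD v (dirD u f) ((x + s *\<^sub>R u) + t *\<^sub>R v)"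
    using MVT2[OF h, of "\<lambda>t. dirD u f ((x + s *\<^sub>R u) + t *\<^sub>R v)"
        "\<lambda>t. dirD v (dirD u f) ((x + s *\<^sub>R u) + t *\<^sub>R v)"] by blast
  have "\<phi>' s = h * dirD v (dirD u f) (x + s *\<^sub>R u + t *\<^sub>R v)"
    using t(3) by (simp add: \<phi>'_def algebra_simps)
  moreover have "\<phi> h - \<phi> 0
      = f (x + h *\<^sub>R u + h *\<^sub>R v) - f (x + h *\<^sub>R u) - f (x + h *\<^sub>R v) + f x"
    by (simp add: \<phi>_def algebra_simps)
  ultimately show thesis
    using that[of s t] s t by (simp add: power2_eq_square)
qed

lemma dirD_commute_real:
  fixes f :: "'a::euclidean_space \<Rightarrow> real"
  assumes S: "open S" "x \<in> S" and f: "Ck 2 S f" and uv: "u \<in> Basis" "v \<in> Basis"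
  shows "dirD u (dirD v f) x = dirD v (dirD u f) x"
proof -
  have *: "Ck (Suc (Suc 0)) S f" using f by (simp add: numeral_2_eq_2)
  have d1: "f differentiable at y" if "y \<in> S" for y using * that by auto
  have d2: "dirD b f differentiable at y" if "y \<in> S" "b \<in> Basis" for y b using * that by auto
  have c: "isCont (dirD a (dirD b f)) x" if "a \<in> Basis" "b \<in> Basis" for a b
    using Ck_SucD(2)[OF Ck_SucD(2)[OF * that(2)] that(1)] S
    by (simp add: continuous_on_eq_continuous_at)
  have "\<bar>dirD u (dirD v f) x - dirD v (dirD u f) x\<bar> < e" if e: "e > 0" for e
  proof -
    have "\<forall>\<^sub>F y in nhds x. dist (dirD u (dirD v f) y) (dirD u (dirD v f) x) < e / 2"
      "\<forall>\<^sub>F y in nhds x. dist (dirD v (dirD u f) y) (dirD v (dirD u f) x) < e / 2"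
      "\<forall>\<^sub>F y in nhds x. y \<in> S"
      using tendstoD[OF c[OF uv, unfolded isCont_def tendsto_at_iff_tendsto_nhds], of "e / 2"]
        tendstoD[OF c[OF uv(2,1), unfolded isCont_def tendsto_at_iff_tendsto_nhds], of "e / 2"]
        eventually_nhds_in_open[OF S] e by simp_all
    then have "\<forall>\<^sub>F y in nhds x. y \<in> S \<and> dist (dirD u (dirD v f) y) (dirD u (dirD v f) x) < e / 2
        \<and> dist (dirD v (dirD u f) y) (dirD v (dirD u f) x) < e / 2"
      by eventually_elim auto
    then obtain r where r: "r > 0" "\<And>y. dist y x < r \<Longrightarrow> y \<in> S
        \<and> dist (dirD u (dirD v f) y) (dirD u (dirD v f) x) < e / 2
        \<and> dist (dirD v (dirD u f) y) (dirD v (dirD u f) x) < e / 2"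
      unfolding eventually_nhds_metric by blast
    \<comment> \<open>The points \<open>x + s *\<^sub>R a + t *\<^sub>R b\<close> with
      \<open>s, t \<le> h\<close> are at distance at most \<open>2 * h < r\<close> from
      \<open>x\<close>.\<close>
    define h where "h = r / 3"
    have h: "h > 0" using r by (simp add: h_def)
    have near: "dist (x + s *\<^sub>R a + t *\<^sub>R b) x < r"
      if "0 \<le> s" "s \<le> h" "0 \<le> t" "t \<le> h" "a \<in> Basis" "b \<in> Basis" for s t a b
    proof -
      have "norm (s *\<^sub>R a + t *\<^sub>R b) \<le> s + t"
        using norm_triangle_ineq[of "s *\<^sub>R a" "t *\<^sub>R b"] that by simp
      then show ?thesis using that r(1) by (simp add: dist_norm h_def add.assoc)
    qed
    obtain s t where st: "0 \<le> s" "s \<le> h" "0 \<le> t" "t \<le> h"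
      "f (x + h *\<^sub>R u + h *\<^sub>R v) - f (x + h *\<^sub>R u) - f (x + h *\<^sub>R v) + f x
        = h\<^sup>2 * dirD v (dirD u f) (x + s *\<^sub>R u + t *\<^sub>R v)"
      by (rule second_difference_mvt[OF h, of f x u v]) (use d1 d2 near r uv in blast)+
    obtain s' t' where st': "0 \<le> s'" "s' \<le> h" "0 \<le> t'" "t' \<le> h"
      "f (x + h *\<^sub>R v + h *\<^sub>R u) - f (x + h *\<^sub>R v) - f (x + h *\<^sub>R u) + f x
        = h\<^sup>2 * dirD u (dirD v f) (x + s' *\<^sub>R v + t' *\<^sub>R u)"
      by (rule second_difference_mvt[OF h, of f x v u]) (use d1 d2 near r uv in blast)+
    \<comment> \<open>The second difference is symmetric in \<open>u\<close> and \<open>v\<close>,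
      so the two mixed derivatives agree, though at two different points near \<open>x\<close>;
      continuity costs e/2 at each of them.\<close>
    have "h\<^sup>2 * dirD u (dirD v f) (x + s' *\<^sub>R v + t' *\<^sub>R u)
        = h\<^sup>2 * dirD v (dirD u f) (x + s *\<^sub>R u + t *\<^sub>R v)"
      using st(5) st'(5) by (simp only: add.commute[of "h *\<^sub>R v" "h *\<^sub>R u"] add.assoc)
    then have "dirD u (dirD v f) (x + s' *\<^sub>R v + t' *\<^sub>R u) = dirD v (dirD u f) (x + s *\<^sub>R u + t *\<^sub>R v)"
      using h by (simp only: mult_cancel_left) simp
    moreover note r(2)[OF near[OF st(1-4) uv]] r(2)[OF near[OF st'(1-4) uv(2,1)]]
    ultimately show ?thesis unfolding dist_real_def by (simp only:) linarith
  qed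
  from this[of "\<bar>dirD u (dirD v f) x - dirD v (dirD u f) x\<bar>"] show ?thesis by auto
qed

lemma dirD_commute:
  fixes f :: "'a::euclidean_space \<Rightarrow> 'b::euclidean_space"
  assumes S: "open S" "x \<in> S" and f: "Ck 2 S f" and uv: "u \<in> Basis" "v \<in> Basis"
  shows "dirD u (dirD v f) x = dirD v (dirD u f) x"
proof (rule euclidean_eqI)
  fix c :: 'b assume "c \<in> Basis"
  have *: "Ck (Suc (Suc 0)) S f" using f by (simp add: numeral_2_eq_2)
  have lin: "((\<lambda>y. g y \<bullet> c) has_derivative (\<lambda>v. dirD v g y \<bullet> c)) (at y)"
    if "g differentiable at y" for g :: "'a \<Rightarrow> 'b" and y
    using bounded_linear.has_derivative[OF bounded_linear_inner_left dirD_works[OF that]] .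
  have 2: "dirD a (dirD b (\<lambda>y. f y \<bullet> c)) x = dirD a (dirD b f) x \<bullet> c" if "a \<in> Basis" "b \<in> Basis" for a b
  proof -
    have "dirD a (dirD b (\<lambda>y. f y \<bullet> c)) x = dirD a (\<lambda>y. dirD b f y \<bullet> c) x"
      using * by (intro dirD_cong[OF S] dirD_eq lin) auto
    also have "\<dots> = dirD a (dirD b f) x \<bullet> c"
      using * S that by (intro dirD_eq lin) auto
    finally show ?thesis .
  qed
  show "dirD u (dirD v f) x \<bullet> c = dirD v (dirD u f) x \<bullet> c"
    using dirD_commute_real[OF S Ck_linear_comp[OF bounded_linear_inner_left S(1) f] uv, of c] 2 uv by simp
qed

subsection \<open>Exterior algebra in components\<close>

lemma shuffle_sign_singleton: "shuffle_sign {i} J = (-1) ^ card {j \<in> J. j < i}"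
proof -
  have "{(a, b). a \<in> {i} \<and> b \<in> J \<and> b < a} = Pair i ` {j \<in> J. j < i}" by auto
  then show ?thesis by (simp add: shuffle_sign_def card_image inj_on_def)
qed

lemma shuffle_sign_singleton_insert:
  fixes i :: "'n::{finite,linorder}"
  assumes "j \<notin> J"
  shows "shuffle_sign {i} (insert j J) = (if j < i then - shuffle_sign {i} J else shuffle_sign {i} J)"
proof (cases "j < i")
  case True
  then have "{a \<in> insert j J. a < i} = insert j {a \<in> J. a < i}" by auto
  then show ?thesis using assms True by (simp add: shuffle_sign_singleton)
next
  case False
  then have "{a \<in> insert j J. a < i} = {a \<in> J. a < i}" by auto
  then show ?thesis using False by (simp add: shuffle_sign_singleton)
qed

lemma wedge_dx_nth:
  "(dx i \<and>\<^sub>w a) $ K = (if i \<in> K then shuffle_sign {i} (K - {i}) * a $ (K - {i}) else 0)"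
proof -
  have "(dx i \<and>\<^sub>w a) $ K = (\<Sum>I\<in>Pow K. shuffle_sign I (K - I) * dx i $ I * a $ (K - I))"
    by (simp add: wedge_def)
  also have "\<dots> = (\<Sum>I\<in>Pow K. if {i} = I then shuffle_sign I (K - I) * a $ (K - I) else 0)"
    by (rule sum.cong) (auto simp: dx_def axis_def)
  finally show ?thesis by simp
qed

lemma wedge_dx_anticommute: "dx i \<and>\<^sub>w dx j \<and>\<^sub>w a = - (dx j \<and>\<^sub>w dx i \<and>\<^sub>w a)"
proof -
  have "(dx i \<and>\<^sub>w dx j \<and>\<^sub>w a) $ K = - (dx j \<and>\<^sub>w dx i \<and>\<^sub>w a) $ K" for K
  proof (cases "i \<in> K \<and> j \<in> K \<and> i \<noteq> j")
    case True
    \<comment> \<open>Both sides reduce to the coefficient at \<open>L\<close>. Of \<open>i\<close>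
      and \<open>j\<close> exactly one is the larger, and only the sign of the larger one changes
      when the other index is inserted into \<open>L\<close>.\<close>
    define L where "L = K - {i} - {j}"
    have L: "K - {i} = insert j L" "K - {j} = insert i L" "i \<notin> L" "j \<notin> L"
      using True unfolding L_def by blast+
    have M: "insert j L - {j} = L" "insert i L - {i} = L" using L by simp_all
    have "i < j \<or> j < i" using True by auto
    then have "shuffle_sign {i} (insert j L) * shuffle_sign {j} L
        = - (shuffle_sign {j} (insert i L) * shuffle_sign {i} L)"
      unfolding shuffle_sign_singleton_insert[OF L(3)] shuffle_sign_singleton_insert[OF L(4)]
      by auto
    from arg_cong[OF this, of "\<lambda>t. t * a $ L"] show ?thesis
      using True by (simp add: wedge_dx_nth L(1,2) M mult.assoc del: insert_Diff_single)
  qed (auto simp: wedge_dx_nth)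
  then show ?thesis by (simp add: vec_eq_iff)
qed

lemma linear_wedge_flip: "linear (\<lambda>a. a \<and>\<^sub>w b)"
  by (rule linearI)
    (simp_all add: wedge_def vec_eq_iff algebra_simps sum.distrib sum_distrib_left)

lemma wedge_dx_axis: "dx i \<and>\<^sub>w axis {} 1 = dx i"
proof -
  have "(dx i \<and>\<^sub>w axis {} 1) $ K = dx i $ K" for K
  proof (cases "K = {i}")
    case False
    then have "i \<in> K \<Longrightarrow> K - {i} \<noteq> {}" by auto
    then show ?thesis using False by (simp add: wedge_dx_nth) (simp add: dx_def axis_def)
  qed (simp add: wedge_dx_nth, simp add: dx_def axis_def shuffle_sign_singleton)
  then show ?thesis by (simp add: vec_eq_iff)
qed

lemma wedge_scaleR_right: "a \<and>\<^sub>w (c *\<^sub>R b) = c *\<^sub>R (a \<and>\<^sub>w b)"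
  by (rule linear_scale[OF linear_wedge])

lemma wedge_sum_right: "a \<and>\<^sub>w (\<Sum>i\<in>I. f i) = (\<Sum>i\<in>I. a \<and>\<^sub>w f i)"
  by (rule linear_sum[OF linear_wedge])

lemma wedge_add_right: "a \<and>\<^sub>w (b + c) = a \<and>\<^sub>w b + a \<and>\<^sub>w c"
  by (rule linear_add[OF linear_wedge])

lemma wedge_diff_right: "a \<and>\<^sub>w (b - c) = a \<and>\<^sub>w b - a \<and>\<^sub>w c"
  by (rule linear_diff[OF linear_wedge])

lemma wedge_minus_right: "a \<and>\<^sub>w (- b) = - (a \<and>\<^sub>w b)"
  by (rule linear_neg[OF linear_wedge])

lemmas wedge_linear_simps = wedge_scaleR_right wedge_sum_right wedge_add_right wedge_diff_right
  wedge_minus_right wedge_0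

lemma bounded_linear_wedge: "bounded_linear (wedge a)"
  using linear_wedge linear_conv_bounded_linear by blast

lemma covecs_wedge_dx:
  assumes "a \<in> covecs k" shows "dx i \<and>\<^sub>w a \<in> covecs (Suc k)"
proof -
  have "card (K - {i}) \<noteq> k" if "card K \<noteq> Suc k" "i \<in> K" for K
    using that card.remove[of K i] by (metis finite)
  then show ?thesis using assms by (simp add: covecs_def wedge_dx_nth)
qed

lemma subspace_covecs: "subspace (covecs k)"
  by (auto simp: covecs_def subspace_def)

text \<open>This is the interior product with the \<open>i\<close>-th basis vector. It is read off
  by matching the sets \<open>K\<close> that contain \<open>i\<close> with the sets
  \<open>K - {i}\<close> that avoid it.\<close>

lemma adjoint_wedge_dx_nth:
  "adjoint (wedge (dx i)) a $ J = (if i \<in> J then 0 else shuffle_sign {i} J * a $ insert i J)"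
proof -
  define g where "g = (\<lambda>a. \<chi> J. if i \<in> J then 0 else shuffle_sign {i} J * a $ insert i J)"
  have "(dx i \<and>\<^sub>w x) \<bullet> y = x \<bullet> g y" for x y
  proof -
    have "(dx i \<and>\<^sub>w x) \<bullet> y = (\<Sum>K\<in>{K. i \<in> K}. shuffle_sign {i} (K - {i}) * x $ (K - {i}) * y $ K)"
      unfolding inner_vec_def by (rule sum.mono_neutral_cong_right) (auto simp: wedge_dx_nth)
    also have "\<dots> = (\<Sum>J\<in>{J. i \<notin> J}. x $ J * (shuffle_sign {i} J * y $ insert i J))"
      by (rule sum.reindex_bij_witness[of _ "insert i" "\<lambda>K. K - {i}"]) (auto simp: insert_absorb)
    also have "\<dots> = x \<bullet> g y"
      unfolding inner_vec_def by (rule sum.mono_neutral_cong_left) (auto simp: g_def)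
    finally show ?thesis .
  qed
  then have "adjoint (wedge (dx i)) = g" by (intro adjoint_unique) blast
  then show ?thesis by (simp add: g_def)
qed

text \<open>Signs for which the Hodge-like map \<open>dual_star\<close> intertwines \<open>dx\<^sub>i \<and> _\<close> with its adjoint in every
  degree, without the degree dependent sign of \<open>*\<close>.\<close>

definition rank_sign :: "('n::{finite,linorder}) set \<Rightarrow> real" where
  "rank_sign J = (\<Prod>j\<in>J. (-1) ^ card {i. i < j})"

definition dual_star :: "('n::{finite,linorder}) covec \<Rightarrow> 'n covec" where
  "dual_star a = (\<chi> J. rank_sign J * a $ (- J))"

definition dual_star_inv :: "('n::{finite,linorder}) covec \<Rightarrow> 'n covec" where
  "dual_star_inv a = (\<chi> J. rank_sign (- J) * a $ (- J))"

lemma rank_sign_square: "rank_sign J * rank_sign J = 1"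
  by (simp add: rank_sign_def prod.distrib[symmetric] flip: power_mult_distrib)

lemma dual_star_inv: "dual_star (dual_star_inv a) = a" "dual_star_inv (dual_star a) = a"
  by (simp_all add: dual_star_def dual_star_inv_def vec_eq_iff rank_sign_square mult.assoc[symmetric])

lemma bounded_linear_dual_star: "bounded_linear dual_star" "bounded_linear dual_star_inv"
  by (auto simp: linear_conv_bounded_linear[symmetric] dual_star_def dual_star_inv_def vec_eq_iff
      algebra_simps intro!: linearI)

lemma covecs_dual_star:
  fixes a :: "('n::{finite,linorder}) covec"
  assumes "a \<in> covecs k" "k \<le> CARD('n)"
  shows "dual_star a \<in> covecs (CARD('n) - k)" "dual_star_inv a \<in> covecs (CARD('n) - k)"
proof -
  have "card (- I) = k \<Longrightarrow> card I = CARD('n) - k" for I :: "'n set"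
    by (metis Compl_eq_Diff_UNIV card_Diff_subset double_complement finite subset_UNIV)
  then show "dual_star a \<in> covecs (CARD('n) - k)" "dual_star_inv a \<in> covecs (CARD('n) - k)"
    using assms by (auto simp: covecs_def dual_star_def dual_star_inv_def)
qed

lemma dual_star_wedge_dx: "dual_star (dx i \<and>\<^sub>w a) = adjoint (wedge (dx i)) (dual_star a)"
proof -
  have "dual_star (dx i \<and>\<^sub>w a) $ J = adjoint (wedge (dx i)) (dual_star a) $ J" for J
  proof (cases "i \<in> J")
    case False
    \<comment> \<open>The indices below \<open>i\<close> are split between \<open>J\<close> and its
      complement. Hence the two shuffle signs differ by the parity of the number of all indices
      below \<open>i\<close>, which is the factor that \<open>rank_sign\<close> gains from
      \<open>i\<close>.\<close>
    have "{j. j < i} = {j \<in> - J - {i}. j < i} \<union> {j \<in> J. j < i}" by auto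
    moreover have "{j \<in> - J - {i}. j < i} \<inter> {j \<in> J. j < i} = {}" by auto
    ultimately have "card {j. j < i} = card {j \<in> - J - {i}. j < i} + card {j \<in> J. j < i}"
      by (metis card_Un_disjoint finite)
    then have "shuffle_sign {i} (- J - {i}) = shuffle_sign {i} J * (-1) ^ card {j. j < i}"
      by (simp add: shuffle_sign_singleton power_add mult.assoc[symmetric] flip: power_mult_distrib)
    moreover have "rank_sign (insert i J) = (-1) ^ card {j. j < i} * rank_sign J"
      using False by (simp add: rank_sign_def)
    moreover have "- insert i J = - J - {i}" by auto
    ultimately show ?thesis
      using False by (simp add: dual_star_def adjoint_wedge_dx_nth wedge_dx_nth)
  qed (simp add: dual_star_def adjoint_wedge_dx_nth wedge_dx_nth)
  then show ?thesis by (simp add: vec_eq_iff)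
qed

lemma eq_neg_imp_eq_0:
  fixes x :: "'a::real_vector"
  assumes "x = - x" shows "x = 0"
proof -
  have "x + x = x + - x" by (rule arg_cong[OF assms])
  then have "2 *\<^sub>R x = 0" by (simp only: scaleR_2 right_minus)
  then show ?thesis by simp
qed

text \<open>The common core of dd = 0 and of the closedness of gradients: an anticommuting product
  is paired with symmetric second derivatives.\<close>

lemma antisymmetric_sum_0:
  fixes F :: "'i \<Rightarrow> 'i \<Rightarrow> 'a::real_vector"
  assumes "\<And>i j. F i j = - F j i"
  shows "(\<Sum>i\<in>I. \<Sum>j\<in>I. F i j) = 0"
proof (rule eq_neg_imp_eq_0)
  have "(\<Sum>i\<in>I. \<Sum>j\<in>I. F i j) = (\<Sum>i\<in>I. \<Sum>j\<in>I. - F i j)"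
    by (subst sum.swap) (intro sum.cong refl assms)
  then show "(\<Sum>i\<in>I. \<Sum>j\<in>I. F i j) = - (\<Sum>i\<in>I. \<Sum>j\<in>I. F i j)"
    unfolding sum_negf .
qed

text \<open>Moving \<open>E m\<close> to its place in a sorted product passes exactly the letters
  smaller than \<open>m\<close>, each with a change of sign; meeting another \<open>E m\<close>
  gives 0, since anticommutation forces squares to vanish. The operators are kept abstract so that
  the result applies to \<open>cyl_step\<close>.\<close>

lemma foldr_insort_anticommute:
  fixes E :: "'n::{finite,linorder} \<Rightarrow> 'a::real_vector \<Rightarrow> 'a"
  assumes lin: "\<And>i. linear (E i)" and anti: "\<And>i j x. E i (E j x) = - E j (E i x)"
    and "sorted l" "distinct l"
  shows "E m (foldr E l e) =
    (if m \<in> set l then 0 else shuffle_sign {m} (set l) *\<^sub>R foldr E (insort m l) e)"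
  using assms(3,4)
proof (induction l)
  case Nil
  then show ?case by (simp add: shuffle_sign_def)
next
  case (Cons j l)
  have sq: "E j (E j x) = 0" for x by (rule eq_neg_imp_eq_0) (rule anti)
  have j: "j \<notin> set l" and le: "\<And>b. b \<in> set l \<Longrightarrow> j \<le> b" and sd: "sorted l" "distinct l"
    using Cons.prems by simp_all
  consider "m = j" | "m < j" | "j < m" using less_linear by blast
  then show ?case
  proof cases
    case 1
    show ?thesis unfolding 1 by (simp add: sq)
  next
    case 2
    have "{b \<in> set (j # l). b < m} = {}" using 2 le by fastforce
    then have "shuffle_sign {m} (set (j # l)) = 1"
      unfolding shuffle_sign_singleton by (metis card.empty power_0)
    moreover have "m \<notin> set (j # l)" using 2 le by fastforce
    ultimately show ?thesis using 2 by (simp add: less_imp_le)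
  next
    case 3
    have "E m (foldr E (j # l) e) = - E j (E m (foldr E l e))" by (simp add: anti[of m j])
    also have "\<dots> = - E j (if m \<in> set l then 0 else shuffle_sign {m} (set l) *\<^sub>R foldr E (insort m l) e)"
      unfolding Cons.IH[OF sd] ..
    also have "\<dots> = (if m \<in> set l then 0 else - shuffle_sign {m} (set l) *\<^sub>R E j (foldr E (insort m l) e))"
      by (simp add: linear_0[OF lin] linear_scale[OF lin])
    also have "\<dots> = (if m \<in> set (j # l) then 0 else shuffle_sign {m} (set (j # l)) *\<^sub>R foldr E (insort m (j # l)) e)"
    proof -
      have "m \<noteq> j" "\<not> m \<le> j" using 3 by auto
      with 3 j show ?thesis by (simp add: shuffle_sign_singleton_insert)
    qed
    finally show ?thesis .
  qed
qed

lemma foldr_insert_anticommute: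
  fixes E :: "'n::{finite,linorder} \<Rightarrow> 'a::real_vector \<Rightarrow> 'a"
  assumes "\<And>i. linear (E i)" "\<And>i j x. E i (E j x) = - E j (E i x)"
  shows "E m (foldr E (sorted_list_of_set J) e) =
    (if m \<in> J then 0 else shuffle_sign {m} J *\<^sub>R foldr E (sorted_list_of_set (insert m J)) e)"
proof -
  have "m \<notin> J \<Longrightarrow> sorted_list_of_set (insert m J) = insort m (sorted_list_of_set J)"
    by (rule sorted_list_of_set_insert) auto
  moreover have "set (sorted_list_of_set J) = J" by simp
  moreover note foldr_insort_anticommute[of E "sorted_list_of_set J" m e, OF assms sorted_sorted_list_of_set distinct_sorted_list_of_set]
  ultimately show ?thesis by (simp split: if_split del: sorted_list_of_set_insert_remove)
qed

subsection \<open>Exterior derivative and codifferential\<close>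

lemma ext_d_dirD: "ext_d \<omega> x = (\<Sum>i\<in>UNIV. dx i \<and>\<^sub>w dirD (axis i 1) \<omega> x)"
  by (simp add: ext_d_def partial_eq_dirD)

lemma ext_d_cong:
  assumes "open S" "x \<in> S" "\<And>y. y \<in> S \<Longrightarrow> f y = g y"
  shows "ext_d f x = ext_d g x"
  unfolding ext_d_dirD using dirD_cong[OF assms] by simp

lemma codiff_cong:
  assumes "open S" "x \<in> S" "\<And>y. y \<in> S \<Longrightarrow> f y = g y"
  shows "codiff f x = codiff g x"
  unfolding codiff_def partial_eq_dirD using dirD_cong[OF assms] by simp

lemma Ck_ext_d:
  assumes "open S" "Ck (Suc m) S \<omega>"
  shows "Ck m S (ext_d \<omega>)"
  unfolding ext_d_dirD[abs_def]
  by (intro Ck_sum Ck_linear_comp[OF bounded_linear_wedge] assms Ck_SucD(2)[OF assms(2)])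
    (auto simp: Basis_vec_def)

lemma ext_d_ext_d:
  fixes \<omega> :: "('n::{finite,linorder}) form"
  assumes S: "open S" "x \<in> S" and \<omega>: "Ck 2 S \<omega>"
  shows "ext_d (ext_d \<omega>) x = 0"
proof -
  have *: "Ck (Suc (Suc 0)) S \<omega>" using \<omega> by (simp add: numeral_2_eq_2)
  have B: "axis i (1::real) \<in> Basis" for i :: 'n by (auto simp: Basis_vec_def)
  have "(ext_d \<omega> has_derivative (\<lambda>v. \<Sum>i\<in>UNIV. dx i \<and>\<^sub>w dirD v (dirD (axis i 1) \<omega>) x)) (at x)"
    unfolding ext_d_dirD[abs_def]
    by (intro has_derivative_sum bounded_linear.has_derivative[OF bounded_linear_wedge] dirD_works
        Ck_SucD(1)[OF Ck_SucD(2)[OF * B] S(2)])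
  from dirD_eq[OF this] have "ext_d (ext_d \<omega>) x
      = (\<Sum>j\<in>UNIV. \<Sum>i\<in>UNIV. dx j \<and>\<^sub>w dx i \<and>\<^sub>w dirD (axis j 1) (dirD (axis i 1) \<omega>) x)"
    unfolding ext_d_dirD[of "ext_d \<omega>"] by (simp add: wedge_linear_simps)
  also have "\<dots> = 0"
    by (rule antisymmetric_sum_0)
      (subst wedge_dx_anticommute, subst dirD_commute[OF S \<omega> B B], rule refl)
  finally show ?thesis .
qed

text \<open>The intertwining property of \<open>dual_star\<close> holds in every degree, so this
  rule has one sign for all forms and carries statements about \<open>ext_d\<close> over to
  \<open>codiff\<close>.\<close>

lemma codiff_dual_star:
  assumes "f differentiable at x"
  shows "codiff (\<lambda>y. dual_star (f y)) x = - dual_star (ext_d f x)"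
proof -
  have "dirD v (\<lambda>y. dual_star (f y)) x = dual_star (dirD v f x)" for v
    by (rule dirD_eq) (rule bounded_linear.has_derivative[OF bounded_linear_dual_star(1) dirD_works[OF assms]])
  then show ?thesis
    by (simp add: codiff_def ext_d_dirD partial_eq_dirD dual_star_wedge_dx
        linear_sum[OF bounded_linear.linear[OF bounded_linear_dual_star(1)]])
qed

lemma codiff_eq_dual_star:
  assumes "f differentiable at x"
  shows "codiff f x = - dual_star (ext_d (\<lambda>y. dual_star_inv (f y)) x)"
proof -
  have "(\<lambda>y. dual_star_inv (f y)) differentiable at x"
    using bounded_linear.has_derivative[OF bounded_linear_dual_star(2) dirD_works[OF assms]]
    unfolding differentiable_def by blast
  from codiff_dual_star[OF this] show ?thesis by (simp add: dual_star_inv)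
qed

lemma bounded_linear_adjoint_wedge: "bounded_linear (adjoint (wedge a))"
  using adjoint_linear[OF linear_wedge] linear_conv_bounded_linear by blast

lemma Ck_codiff:
  assumes "open S" "Ck (Suc m) S \<omega>"
  shows "Ck m S (codiff \<omega>)"
  unfolding codiff_def partial_eq_dirD
  by (intro Ck_linear_comp[OF bounded_linear_minus[OF bounded_linear_ident]] Ck_sum
      Ck_linear_comp[OF bounded_linear_adjoint_wedge] assms Ck_SucD(2)[OF assms(2)])
    (auto simp: Basis_vec_def)

lemma ext_d_minus:
  assumes "f differentiable at x"
  shows "ext_d (\<lambda>y. - f y) x = - ext_d f x"
proof -
  have "dirD v (\<lambda>y. - f y) x = - dirD v f x" for v
    by (intro dirD_eq has_derivative_minus dirD_works assms)
  then show ?thesis by (simp add: ext_d_dirD wedge_linear_simps sum_negf)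
qed

lemma codiff_codiff:
  assumes S: "open S" "x \<in> S" and \<omega>: "Ck 2 S \<omega>"
  shows "codiff (codiff \<omega>) x = 0"
proof -
  define f where "f = (\<lambda>y. dual_star_inv (\<omega> y))"
  have f: "Ck (Suc (Suc 0)) S f"
    using Ck_linear_comp[OF bounded_linear_dual_star(2) S(1) \<omega>] by (simp add: numeral_2_eq_2 f_def)
  have \<omega>1: "\<omega> differentiable at y" if "y \<in> S" for y
    using \<omega> that by (simp add: numeral_2_eq_2)
  have "codiff (codiff \<omega>) x = codiff (\<lambda>y. dual_star (- ext_d f y)) x"
    using codiff_eq_dual_star[OF \<omega>1]
    by (intro codiff_cong[OF S]) (simp add: f_def linear_neg[OF bounded_linear.linear[OF bounded_linear_dual_star(1)]])
  also have "\<dots> = - dual_star (ext_d (\<lambda>y. - ext_d f y) x)"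
    using Ck_ext_d[OF S(1) f] S by (intro codiff_dual_star) auto
  also have "ext_d (\<lambda>y. - ext_d f y) x = - ext_d (ext_d f) x"
    using Ck_SucD(1)[OF Ck_ext_d[OF S(1) f] S(2)] by (rule ext_d_minus)
  also have "ext_d (ext_d f) x = 0"
    using ext_d_ext_d[OF S] f by (simp add: numeral_2_eq_2)
  finally show ?thesis
    by (simp add: linear_0[OF bounded_linear.linear[OF bounded_linear_dual_star(1)]])
qed

lemma ext_d_zero_form_wedge:
  assumes "f differentiable at x"
  shows "ext_d (zero_form f) x \<and>\<^sub>w a = (\<Sum>i\<in>UNIV. dirD (axis i 1) f x *\<^sub>R (dx i \<and>\<^sub>w a))"
proof -
  have "zero_form f = (\<lambda>y. f y *\<^sub>R axis {} 1)"
    by (auto simp: zero_form_def fun_eq_iff vec_eq_iff axis_def)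
  moreover have "dirD v (\<lambda>y. f y *\<^sub>R (axis {} 1 :: 'a covec)) x = dirD v f x *\<^sub>R axis {} 1" for v
    by (rule dirD_eq) (rule bounded_linear.has_derivative[OF bounded_linear_scaleR_left dirD_works[OF assms]])
  ultimately show ?thesis
    by (simp add: ext_d_dirD wedge_linear_simps wedge_dx_axis linear_sum[OF linear_wedge_flip]
        linear_scale[OF linear_wedge_flip])
qed

lemma ext_d_scaleR:
  assumes "f differentiable at x" "\<omega> differentiable at x"
  shows "ext_d (\<lambda>y. f y *\<^sub>R \<omega> y) x = ext_d (zero_form f) x \<and>\<^sub>w \<omega> x + f x *\<^sub>R ext_d \<omega> x"
proof -
  have "dirD v (\<lambda>y. f y *\<^sub>R \<omega> y) x = f x *\<^sub>R dirD v \<omega> x + dirD v f x *\<^sub>R \<omega> x" for v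
    by (rule dirD_eq) (rule has_derivative_scaleR[OF dirD_works[OF assms(1)] dirD_works[OF assms(2)]])
  then show ?thesis
    by (simp add: ext_d_zero_form_wedge[OF assms(1)] ext_d_dirD[of \<omega>] ext_d_dirD[of "\<lambda>y. f y *\<^sub>R \<omega> y"] wedge_linear_simps sum.distrib scaleR_sum_right)
qed

subsection \<open>Smooth homotopies\<close>

text \<open>A cutoff of finite order, vanishing on the negative half-line. Differentiation only
  lowers the exponent by one and adds a constant factor, which closes the induction.\<close>

lemma Ck_pos_power: "Ck m UNIV (\<lambda>s::real. max 0 s ^ Suc m)"
proof (induction m)
  case 0
  then show ?case by (auto intro!: continuous_intros)
next
  case (Suc m)
  have "((\<lambda>s. max 0 s ^ Suc (Suc m)) has_real_derivative real (Suc (Suc m)) * max 0 s ^ Suc m) (at s)" for s :: real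
  proof -
    consider "s < 0" | "s = 0" | "s > 0" by linarith
    then show ?thesis
    proof cases
      case 1
      have "((\<lambda>s. 0) has_real_derivative 0) (at s)" by simp
      then have "((\<lambda>s. max 0 s ^ Suc (Suc m)) has_real_derivative 0) (at s)"
        by (rule has_field_derivative_transform_within_open[of _ _ _ "{..<0}"]) (use 1 in auto)
      then show ?thesis using 1 by simp
    next
      case 2
      show ?thesis
        \<comment> \<open>At the junction the difference quotient is \<open>max 0 z ^ Suc m\<close>,
          which is continuous with value 0 at the origin.\<close>
        unfolding CARAT_DERIV
      proof (intro exI[of _ "\<lambda>z. max 0 z ^ Suc m"] conjI allI)
        show "isCont (\<lambda>z. max 0 z ^ Suc m) s" by (intro continuous_intros)
      qed (auto simp: 2 max_def)
    next
      case 3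
      have "((\<lambda>s. s ^ Suc (Suc m)) has_real_derivative real (Suc (Suc m)) * s ^ Suc m) (at s)"
        using DERIV_pow[of "Suc (Suc m)" s] by simp
      then have "((\<lambda>s. max 0 s ^ Suc (Suc m)) has_real_derivative real (Suc (Suc m)) * s ^ Suc m) (at s)"
        by (rule has_field_derivative_transform_within_open[of _ _ _ "{0<..}"]) (use 3 in auto)
      then show ?thesis using 3 by simp
    qed
  qed
  then show ?case
    by (rule Ck_Suc_realI[OF open_UNIV])
      (rule Ck_linear_comp[OF bounded_linear_mult_right open_UNIV Suc])
qed

section \<open>Series of C^m functions with geometrically bounded derivatives\<close>

primrec Ck_bound :: "nat \<Rightarrow> real \<Rightarrow> ('a::euclidean_space \<Rightarrow> 'b::real_normed_vector) \<Rightarrow> bool" where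
  "Ck_bound 0 K f \<longleftrightarrow> (\<forall>x. norm (f x) \<le> K)"
| "Ck_bound (Suc m) K f \<longleftrightarrow> (\<forall>x. norm (f x) \<le> K) \<and> (\<forall>b\<in>Basis. Ck_bound m K (dirD b f))"

lemma Ck_bound_mono: "Ck_bound m K f \<Longrightarrow> K \<le> L \<Longrightarrow> Ck_bound m L f"
  by (induction m arbitrary: f) (auto intro: order_trans)

lemma Ck_bound_norm: "Ck_bound m K f \<Longrightarrow> norm (f x) \<le> K"
  by (cases m) auto

lemma Ck_bound_scaleR:
  "Ck m UNIV f \<Longrightarrow> Ck_bound m K f \<Longrightarrow> Ck_bound m (\<bar>c\<bar> * K) (\<lambda>x. c *\<^sub>R f x)"
proof (induction m arbitrary: f)
  case 0
  then show ?case by (auto intro: mult_left_mono)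
next
  case (Suc m)
  have "dirD b (\<lambda>x. c *\<^sub>R f x) = (\<lambda>x. c *\<^sub>R dirD b f x)" for b
    using Suc.prems(1) by (intro ext dirD_eq has_derivative_scaleR_right dirD_works) auto
  then show ?case using Suc by (auto intro: mult_left_mono)
qed

lemma Ck_bound_compact_support:
  assumes "compact T" "Ck m UNIV f" "\<And>x. x \<notin> T \<Longrightarrow> f x = 0"
  shows "\<exists>K. Ck_bound m K f"
  using assms(2,3)
proof (induction m arbitrary: f)
  case (0 f)
  have bnd: "\<exists>K. \<forall>x. norm (f x) \<le> K"
    if "continuous_on UNIV f" "\<And>x. x \<notin> T \<Longrightarrow> f x = 0" for f :: "'a \<Rightarrow> 'b"
  proof -
    have "bounded (f ` T)"
      using that(1) assms(1) by (meson compact_continuous_image compact_imp_bounded continuous_on_subset subset_UNIV)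
    then obtain K where "\<And>x. x \<in> T \<Longrightarrow> norm (f x) \<le> K" by (auto simp: bounded_iff)
    then have "norm (f x) \<le> max K 0" for x using that(2)[of x] by (cases "x \<in> T") fastforce+
    then show ?thesis by blast
  qed
  show ?case using bnd[of f] 0 by simp
next
  case (Suc m f)
  have oT: "open (- T)" using assms(1) compact_imp_closed by blast
  have "dirD b f x = 0" if "x \<notin> T" for b x
    using dirD_cong[OF oT, of x f "\<lambda>_. 0" b] dirD_eq[OF has_derivative_const, of b 0 x] Suc.prems(2) that
    by simp
  then have "\<forall>b\<in>Basis. \<exists>K. Ck_bound m K (dirD b f)"
    using Suc.IH Suc.prems(1) by auto
  then obtain K where K: "\<And>b. b \<in> Basis \<Longrightarrow> Ck_bound m (K b) (dirD b f)" by metis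
  obtain L where "Ck_bound m L f" using Suc.IH[OF Ck_Suc_imp] Suc.prems by blast
  define N where "N = Max (insert L (K ` Basis))"
  have "L \<le> N" "\<And>b. b \<in> Basis \<Longrightarrow> K b \<le> N"
    unfolding N_def by (rule Max_ge; simp)+
  moreover have "norm (f x) \<le> L" for x by (rule Ck_bound_norm[OF \<open>Ck_bound m L f\<close>])
  ultimately have "norm (f x) \<le> N" for x by (meson order_trans)
  then have "Ck_bound (Suc m) N f"
    using Ck_bound_mono[OF K] \<open>\<And>b. b \<in> Basis \<Longrightarrow> K b \<le> N\<close> by simp
  then show ?case by blast
qed

lemma suminf_tail_half_power:
  fixes a :: "nat \<Rightarrow> 'b::banach"
  assumes "\<And>i. norm (a i) \<le> (1/2) ^ i"
  shows "norm (sum a {..<n} - suminf a) \<le> 2 * (1/2) ^ n"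
proof -
  have g: "summable (\<lambda>i. (1/2::real) ^ i)" by (rule summable_geometric) simp
  then have s: "summable a" using assms summable_comparison_test' by blast
  have "(\<lambda>i. (1/2::real) ^ (i + n)) sums ((1/2) ^ n * (1 / (1 - 1/2)))"
    unfolding power_add mult.commute[of _ "(1/2) ^ n"] by (intro sums_mult geometric_sums) simp
  then have t: "(\<lambda>i. (1/2::real) ^ (i + n)) sums (2 * (1/2) ^ n)" by (simp add: mult.commute)
  have "sum a {..<n} - suminf a = - suminf (\<lambda>i. a (i + n))"
    using suminf_split_initial_segment[OF s, of n] by simp
  also have "norm \<dots> \<le> suminf (\<lambda>i. (1/2::real) ^ (i + n))"
    unfolding norm_minus_cancel using assms t by (intro norm_suminf_le sums_summable[OF t])
  also have "\<dots> = 2 * (1/2) ^ n" using t by (rule sums_unique[symmetric])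
  finally show ?thesis .
qed

text \<open>The Weierstrass test for all orders at once. A bound in the sense of
  \<open>Ck_bound\<close> passes with the same constant to the derivatives in basis directions, so
  the induction hypothesis applies to the series of derivatives.\<close>

lemma Ck_suminf:
  fixes f :: "nat \<Rightarrow> 'a::euclidean_space \<Rightarrow> 'b::banach"
  assumes "\<And>n. Ck m UNIV (f n)" "\<And>n. Ck_bound m ((1/2) ^ n) (f n)"
  shows "Ck m UNIV (\<lambda>x. \<Sum>n. f n x)"
  using assms
proof (induction m arbitrary: f)
  case 0
  have "uniform_limit UNIV (\<lambda>n x. \<Sum>i<n. f i x) (\<lambda>x. \<Sum>n. f n x) sequentially"
    using 0(2) by (intro Weierstrass_m_test[where M = "\<lambda>n. (1/2) ^ n"]) (auto intro: summable_geometric)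
  moreover have "\<forall>\<^sub>F n in sequentially. continuous_on UNIV (\<lambda>x. \<Sum>i<n. f i x)"
    using 0(1) by (intro always_eventually allI continuous_on_sum) simp
  ultimately have "continuous_on UNIV (\<lambda>x. \<Sum>n. f n x)"
    by (intro uniform_limit_theorem[OF _ _ sequentially_bot])
  then show ?case by simp
next
  case (Suc m)
  have bd: "norm (dirD b (f n) x) \<le> (1/2) ^ n" if "b \<in> Basis" for b n x
    using Suc.prems(2)[of n] that by (auto intro: Ck_bound_norm)
  \<comment> \<open>The candidate derivative: termwise differentiation in the basis directions,
    extended linearly. Summing the geometric tails over the basis gives the factor
    \<open>2 * real DIM('a)\<close> in the estimate below, uniformly in \<open>x\<close>.\<close>
  define g' where "g' = (\<lambda>x h. \<Sum>b\<in>Basis. (h \<bullet> b) *\<^sub>R (\<Sum>n. dirD b (f n) x))"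
  have df: "f n differentiable at x" for n x using Suc.prems(1)[of n] by auto
  have est: "norm ((\<Sum>i<n. dirD h (f i) x) - g' x h) \<le> (2 * real DIM('a)) * (1/2) ^ n * norm h" for n x h
  proof -
    have "(\<Sum>i<n. dirD h (f i) x) = (\<Sum>b\<in>Basis. (h \<bullet> b) *\<^sub>R (\<Sum>i<n. dirD b (f i) x))"
      unfolding dirD_expand[OF df, of h] scaleR_sum_right by (rule sum.swap)
    then have "(\<Sum>i<n. dirD h (f i) x) - g' x h
        = (\<Sum>b\<in>Basis. (h \<bullet> b) *\<^sub>R ((\<Sum>i<n. dirD b (f i) x) - (\<Sum>i. dirD b (f i) x)))"
      by (simp add: g'_def scaleR_diff_right sum_subtractf)
    also have "norm \<dots> \<le> (\<Sum>b\<in>(Basis::'a set). norm h * (2 * (1/2) ^ n))"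
    proof (intro sum_norm_le)
      fix b :: 'a assume b: "b \<in> Basis"
      show "norm ((h \<bullet> b) *\<^sub>R ((\<Sum>i<n. dirD b (f i) x) - (\<Sum>i. dirD b (f i) x))) \<le> norm h * (2 * (1/2) ^ n)"
        unfolding norm_scaleR
        by (intro mult_mono suminf_tail_half_power bd[OF b]) (simp_all add: Basis_le_norm[OF b])
    qed
    finally show ?thesis by (simp add: mult_ac)
  qed
  have "\<exists>g. \<forall>x\<in>UNIV. (\<lambda>n. f n x) sums g x \<and> (g has_derivative g' x) (at x)"
  proof (rule has_derivative_series[where f' = "\<lambda>n x h. dirD h (f n) x" and x = 0 and l = "\<Sum>n. f n 0"])
    fix e :: real assume e: "e > 0"
    have "(\<lambda>n. (2 * real DIM('a)) * (1/2) ^ n) \<longlonglongrightarrow> (2 * real DIM('a)) * 0"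
      by (intro tendsto_mult tendsto_const LIMSEQ_realpow_zero) auto
    then have "\<forall>\<^sub>F n in sequentially. (2 * real DIM('a)) * (1/2) ^ n < e"
      using e by (intro order_tendstoD) auto
    then show "\<forall>\<^sub>F n in sequentially. \<forall>x\<in>UNIV. \<forall>h. norm ((\<Sum>i<n. dirD h (f i) x) - g' x h) \<le> e * norm h"
    proof eventually_elim
      case (elim n)
      show ?case
        using less_imp_le[OF elim] by (intro ballI allI order_trans[OF est] mult_right_mono) auto
    qed
  next
    show "(\<lambda>n. f n 0) sums (\<Sum>n. f n 0)"
      by (rule summable_sums, rule summable_comparison_test'[of "\<lambda>n. (1/2) ^ n" 0])
        (auto intro!: summable_geometric Ck_bound_norm[OF Suc.prems(2)])
  qed (simp_all add: dirD_works df)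
  then obtain g where g: "\<And>x. (\<lambda>n. f n x) sums g x" "\<And>x. (g has_derivative g' x) (at x)" by blast
  have eq: "(\<lambda>x. \<Sum>n. f n x) = g" by (rule ext) (rule sums_unique[OF g(1), symmetric])
  show ?case
    unfolding eq
  proof (rule Ck_SucI)
    fix c :: 'a assume c: "c \<in> Basis"
    have "g' x c = (\<Sum>n. dirD c (f n) x)" for x
    proof -
      have "g' x c = (\<Sum>b\<in>Basis. if c = b then \<Sum>n. dirD b (f n) x else 0)"
        unfolding g'_def using c by (intro sum.cong) (auto simp: inner_Basis)
      then show ?thesis using c by simp
    qed
    moreover have "Ck m UNIV (\<lambda>x. \<Sum>n. dirD c (f n) x)"
      using Suc.prems c by (intro Suc.IH) auto
    ultimately show "Ck m UNIV (\<lambda>x. g' x c)" by simp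
  qed (use g in auto)
qed

section \<open>Averaging local selections with values in convex sets\<close>

lemma convex_countable_combination:
  fixes p :: "nat \<Rightarrow> 'b::real_normed_vector"
  assumes C: "closed C" "convex C" and w: "\<And>i. 0 \<le> w i" "\<And>i. 0 < w i \<Longrightarrow> p i \<in> C"
    and S: "w sums s" "0 < s" and N: "(\<lambda>i. w i *\<^sub>R p i) sums q"
  shows "inverse s *\<^sub>R q \<in> C"
proof -
  have lim: "(\<lambda>n. inverse (sum w {..<n}) *\<^sub>R (\<Sum>i<n. w i *\<^sub>R p i)) \<longlonglongrightarrow> inverse s *\<^sub>R q"
    using S N unfolding sums_def by (intro tendsto_scaleR tendsto_inverse) auto
  have "\<forall>\<^sub>F n in sequentially. 0 < sum w {..<n}"
    using S unfolding sums_def by (rule order_tendstoD)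
  then have ev: "\<forall>\<^sub>F n in sequentially. inverse (sum w {..<n}) *\<^sub>R (\<Sum>i<n. w i *\<^sub>R p i) \<in> C"
  proof eventually_elim
    case (elim n)
    \<comment> \<open>Points of weight zero may lie outside \<open>C\<close>, so they are dropped
      before convexity is used.\<close>
    define I where "I = {i \<in> {..<n}. 0 < w i}"
    have I: "sum w {..<n} = sum w I" "(\<Sum>i<n. w i *\<^sub>R p i) = (\<Sum>i\<in>I. w i *\<^sub>R p i)"
      using w(1) by (auto simp: I_def less_le intro!: sum.mono_neutral_right)
    have "(\<Sum>i\<in>I. (inverse (sum w I) * w i) *\<^sub>R p i) \<in> C"
      using elim w C(2) by (intro convex_sum) (auto simp: I I_def sum_distrib_left[symmetric] intro!: sum_nonneg)
    then show ?case by (simp add: I scaleR_sum_right)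
  qed
  show ?thesis
    by (rule Lim_in_closed_set[OF C(1) ev sequentially_bot lim])
qed

text \<open>A partition of unity argument without local finiteness: countably many local selections
  are averaged with positive coefficients so small that the series of weights and of weighted
  selections converge with all derivatives up to order \<open>m\<close>. Local selections are C^m on
  the whole space, so that their products with compactly supported weights have bounded
  derivatives.\<close>

lemma smooth_selection:
  fixes C :: "'a::euclidean_space \<Rightarrow> 'b::euclidean_space set"
  assumes M: "open M" and C: "\<And>x. x \<in> M \<Longrightarrow> closed (C x)" "\<And>x. x \<in> M \<Longrightarrow> convex (C x)"
    and loc: "\<And>z. z \<in> M \<Longrightarrow> \<exists>e>0. \<exists>p. Ck m UNIV p \<and> (\<forall>x\<in>ball z e \<inter> M. p x \<in> C x)"
  obtains h where "Ck m M h" "\<And>x. x \<in> M \<Longrightarrow> h x \<in> C x"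
proof (cases "M = {}")
  case True
  show ?thesis using that[of "\<lambda>_. 0"] True by (simp add: Ck_const)
next
  case False
  obtain e p where ep: "\<And>z. z \<in> M \<Longrightarrow> 0 < e z" "\<And>z. z \<in> M \<Longrightarrow> Ck m UNIV (p z)"
    "\<And>z x. z \<in> M \<Longrightarrow> x \<in> ball z (e z) \<Longrightarrow> x \<in> M \<Longrightarrow> p z x \<in> C x"
    using loc by (metis IntI)
  obtain F where F: "F \<subseteq> (\<lambda>z. ball z (e z)) ` M" "countable F" "\<Union>F = \<Union>((\<lambda>z. ball z (e z)) ` M)"
    using Lindelof[of "(\<lambda>z. ball z (e z)) ` M"] by blast
  then obtain Z where Z: "countable Z" "Z \<subseteq> M" "F = (\<lambda>z. ball z (e z)) ` Z"
    using countable_subset_image[of F "\<lambda>z. ball z (e z)" M] by auto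
  have cov: "M \<subseteq> (\<Union>z\<in>Z. ball z (e z))"
    using F(3) Z(3) ep(1) by force
  then have "Z \<noteq> {}" using False by auto
  define z where "z = from_nat_into Z"
  have z: "z i \<in> M" for i using Z(2) from_nat_into[OF \<open>Z \<noteq> {}\<close>] by (auto simp: z_def)
  have zcov: "\<exists>i. x \<in> ball (z i) (e (z i))" if "x \<in> M" for x
    using cov that from_nat_into_surj[OF Z(1)] unfolding z_def by (metis UN_E subsetD)
  \<comment> \<open>A bump that is positive exactly on the \<open>i\<close>-th ball; the exponent
    \<open>Suc m\<close> makes it C^m across the boundary sphere.\<close>
  define \<phi> where "\<phi> = (\<lambda>i x. max 0 ((e (z i))\<^sup>2 - (x - z i) \<bullet> (x - z i)) ^ Suc m)"
  have pos: "0 < \<phi> i x \<longleftrightarrow> x \<in> ball (z i) (e (z i))" for i x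
  proof -
    have "0 < \<phi> i x \<longleftrightarrow> (norm (x - z i))\<^sup>2 < (e (z i))\<^sup>2"
      unfolding \<phi>_def power2_norm_eq_inner zero_less_power_eq by (auto simp: max_def zero_less_mult_iff)
    also have "\<dots> \<longleftrightarrow> norm (x - z i) < e (z i)"
      using ep(1)[OF z[of i]] by (metis abs_norm_cancel abs_of_pos power2_less_imp_less norm_ge_zero
          order_less_imp_le power_strict_mono zero_less_numeral)
    finally show ?thesis by (simp add: dist_norm norm_minus_commute)
  qed
  have nonneg: "0 \<le> \<phi> i x" for i x by (simp add: \<phi>_def)
  have zero: "\<phi> i x = 0" if "x \<notin> cball (z i) (e (z i))" for i x
    using pos[of i x] nonneg[of i x] that by auto
  have C\<phi>: "Ck m UNIV (\<phi> i)" for i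
  proof -
    have l: "Ck m UNIV (\<lambda>x. x - z i)"
      using Ck_add[OF open_UNIV Ck_linear[OF bounded_linear_ident] Ck_const[of _ _ "- z i"]] by simp
    have "Ck m UNIV (\<lambda>x. (e (z i))\<^sup>2 + - ((x - z i) \<bullet> (x - z i)))"
      by (intro Ck_add[OF open_UNIV] Ck_const Ck_linear_comp[OF bounded_linear_minus[OF bounded_linear_ident] open_UNIV]
          Ck_bilinear[OF bounded_bilinear_inner open_UNIV] l)
    then have "Ck m UNIV (\<lambda>x. (e (z i))\<^sup>2 - (x - z i) \<bullet> (x - z i))" by simp
    from Ck_compose[OF open_UNIV subset_UNIV this Ck_pos_power] show ?thesis by (simp only: \<phi>_def)
  qed
  have C\<psi>: "Ck m UNIV (\<lambda>x. \<phi> i x *\<^sub>R p (z i) x)" for i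
    by (intro Ck_bilinear[OF bounded_bilinear_scaleR open_UNIV] C\<phi> ep z)
  have "\<exists>K. Ck_bound m K (\<phi> i)" for i
    by (rule Ck_bound_compact_support[OF compact_cball C\<phi>]) (use zero in auto)
  then obtain K1 where K1: "\<And>i. Ck_bound m (K1 i) (\<phi> i)" by metis
  have "\<exists>K. Ck_bound m K (\<lambda>x. \<phi> i x *\<^sub>R p (z i) x)" for i
    by (rule Ck_bound_compact_support[OF compact_cball C\<psi>]) (use zero in auto)
  then obtain K2 where K2: "\<And>i. Ck_bound m (K2 i) (\<lambda>x. \<phi> i x *\<^sub>R p (z i) x)" by metis
  \<comment> \<open>The denominator dominates both derivative bounds, so one coefficient brings the
    weight and the weighted selection below \<open>(1/2) ^ i\<close>. The summand 1 keeps it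
    positive.\<close>
  define c where "c = (\<lambda>i. (1/2) ^ i / (1 + \<bar>K1 i\<bar> + \<bar>K2 i\<bar>))"
  have c: "0 < c i" "\<bar>c i\<bar> * K1 i \<le> (1/2) ^ i" "\<bar>c i\<bar> * K2 i \<le> (1/2) ^ i" for i
    by (auto simp: c_def divide_simps abs_if mult_left_mono)
  define w where "w = (\<lambda>i x. c i *\<^sub>R \<phi> i x)"
  define q where "q = (\<lambda>i x. c i *\<^sub>R (\<phi> i x *\<^sub>R p (z i) x))"
  have bw: "Ck_bound m ((1/2) ^ i) (w i)" and bq: "Ck_bound m ((1/2) ^ i) (q i)" for i
    unfolding w_def q_def
    by (rule Ck_bound_mono[OF Ck_bound_scaleR[OF C\<phi> K1] c(2)])
      (rule Ck_bound_mono[OF Ck_bound_scaleR[OF C\<psi> K2] c(3)])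
  have Cw: "Ck m UNIV (w i)" and Cq: "Ck m UNIV (q i)" for i
    unfolding w_def q_def by (intro Ck_linear_comp[OF bounded_linear_scaleR_right open_UNIV] C\<phi> C\<psi>)+
  define W where "W = (\<lambda>x. \<Sum>i. w i x)"
  define Q where "Q = (\<lambda>x. \<Sum>i. q i x)"
  have sums: "(\<lambda>i. w i x) sums W x" "(\<lambda>i. q i x) sums Q x" for x
    unfolding W_def Q_def
    by (rule summable_sums, rule summable_comparison_test'[of "\<lambda>n. (1/2) ^ n" 0],
        auto intro!: summable_geometric Ck_bound_norm[OF bw] Ck_bound_norm[OF bq] simp del: real_norm_def)+
  have Wpos: "0 < W x" if x: "x \<in> M" for x
  proof -
    obtain i where "x \<in> ball (z i) (e (z i))" using zcov[OF x] by blast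
    then have "0 < w i x" using pos c(1) by (simp add: w_def)
    moreover have "0 \<le> w j x" for j using nonneg c(1)[of j] by (simp add: w_def)
    ultimately show ?thesis using sums(1)[of x] unfolding W_def
      by (intro suminf_pos2) (auto simp: sums_iff)
  qed
  have "Ck m M (\<lambda>x. inverse (W x) *\<^sub>R Q x)"
  proof (intro Ck_bilinear[OF bounded_bilinear_scaleR M])
    have "Ck m UNIV W" "Ck m UNIV Q"
      unfolding W_def Q_def by (intro Ck_suminf Cw Cq bw bq)+
    then have *: "Ck m M W" "Ck m M Q" using Ck_subset by blast+
    then show "Ck m M Q" by blast
    show "Ck m M (\<lambda>x. inverse (W x))"
      by (rule Ck_compose[OF M _ *(1) Ck_inverse]) (use Wpos in force)
  qed
  moreover have "inverse (W x) *\<^sub>R Q x \<in> C x" if x: "x \<in> M" for x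
  proof (rule convex_countable_combination[OF C(1)[OF x] C(2)[OF x], of "\<lambda>i. w i x" "\<lambda>i. p (z i) x"])
    show "(\<lambda>i. w i x *\<^sub>R p (z i) x) sums Q x" using sums(2)[of x] by (simp add: w_def q_def)
    show "p (z i) x \<in> C x" if "0 < w i x" for i
      using that c(1)[of i] pos[of i x] x z ep(3) by (simp add: w_def zero_less_mult_iff)
    show "0 \<le> w i x" for i using nonneg c(1)[of i] by (simp add: w_def)
  qed (use sums(1) Wpos[OF x] in auto)
  ultimately show ?thesis using that by blast
qed

section \<open>From a continuous contraction to a differentiable one\<close>

lemma contractible_smooth_homotopy:
  fixes \<Omega> :: "'a::euclidean_space set"
  assumes \<Omega>: "open \<Omega>" "contractible \<Omega>"
  obtains a and H :: "'a \<times> real \<Rightarrow> 'a"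
  where "Ck m (\<Omega> \<times> UNIV) H" "\<And>x t. x \<in> \<Omega> \<Longrightarrow> H (x, t) \<in> \<Omega>"
    "\<And>x t. x \<in> \<Omega> \<Longrightarrow> t \<le> -1 \<Longrightarrow> H (x, t) = a" "\<And>x t. x \<in> \<Omega> \<Longrightarrow> 2 \<le> t \<Longrightarrow> H (x, t) = x"
proof -
  obtain a h where ch: "continuous_map (prod_topology (top_of_set {0..1::real}) (top_of_set \<Omega>)) (top_of_set \<Omega>) h"
    and h01: "\<And>x. h (0, x) = x" "\<And>x. h (1, x) = a"
    using \<Omega>(2) unfolding contractible_def homotopic_with_def by auto
  have h: "continuous_on ({0..1::real} \<times> \<Omega>) h" "h ` ({0..1} \<times> \<Omega>) \<subseteq> \<Omega>"
    using ch by (auto simp: continuous_map_subtopology_eu image_subset_iff_funcset)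
  \<comment> \<open>The contraction \<open>h\<close> starts at the identity and ends at a constant.
    \<open>G\<close> reverses time and clamps it to \<open>[0, 1]\<close>, so it is constant for
    times at most 0 and the identity for times at least 1.\<close>
  define G where "G = (\<lambda>z. h (1 - max 0 (min 1 (snd z)), fst z))"
  define M where "M = \<Omega> \<times> (UNIV :: real set)"
  have M: "open M" using \<Omega>(1) by (simp add: M_def open_Times)
  have cG: "continuous_on M G"
    unfolding G_def by (rule continuous_on_compose2[OF h(1)]) (auto simp: M_def intro!: continuous_intros)
  have G\<Omega>: "G z \<in> \<Omega>" if "z \<in> M" for z
    using h(2) that by (force simp: G_def M_def)
  \<comment> \<open>Half the distance to the complement keeps the closed ball inside
    \<open>\<Omega>\<close>. The whole space is treated apart because \<open>infdist\<close> to the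
    empty set is 0, which is no positive radius.\<close>
  define r where "r = (\<lambda>y. if \<Omega> = UNIV then 1 else infdist y (- \<Omega>) / 2)"
  have cr: "continuous_on UNIV r"
    unfolding r_def by (cases "\<Omega> = UNIV") (auto intro!: continuous_intros)
  have rpos: "0 < r y" if "y \<in> \<Omega>" for y
    using that \<Omega>(1) in_closed_iff_infdist_zero[of "- \<Omega>" y] infdist_nonneg[of y "- \<Omega>"]
    by (auto simp: r_def less_le)
  have rcball: "cball y (r y) \<subseteq> \<Omega>" if "y \<in> \<Omega>" for y
  proof (rule ccontr)
    assume "\<not> cball y (r y) \<subseteq> \<Omega>"
    then obtain x where "x \<notin> \<Omega>" "x \<in> cball y (r y)" by blast
    then have x: "x \<notin> \<Omega>" "dist y x \<le> r y" by simp_all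
    then have "infdist y (- \<Omega>) \<le> dist y x" by (intro infdist_le) auto
    moreover have "r y = infdist y (- \<Omega>) / 2" using x by (auto simp: r_def)
    ultimately show False using x rpos[OF that] by auto
  qed
  \<comment> \<open>Singletons force the exact end behaviour, and balls around \<open>G\<close>
    leave room for averaging in between. As \<open>G\<close> is already constant on
    \<open>[-1, 0]\<close> and already the identity on \<open>[1, 2]\<close>, the end values are
    admissible there too, and a selection can cross the times -1 and 2.\<close>
  define C where "C = (\<lambda>z. if snd z \<le> -1 then {a} else if snd z \<ge> 2 then {fst z} else cball (G z) (r (G z)))"
  have Ga: "G z = a" if "z \<in> M" "snd z \<le> 0" for z using that h01(2) by (auto simp: G_def M_def)
  have Gx: "G z = fst z" if "z \<in> M" "snd z \<ge> 1" for z using that h01(1) by (auto simp: G_def M_def)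
  have CG: "G z \<in> C z" if "z \<in> M" for z
    using Ga[OF that] Gx[OF that] rpos[OF G\<Omega>[OF that]] by (auto simp: C_def)
  have dsnd: "\<bar>snd x - snd z\<bar> < e" if "x \<in> ball z e" for x z :: "'a \<times> real" and e
    using that dist_snd_le[of z x] by (auto simp: dist_real_def abs_minus_commute)
  obtain H where H: "Ck m M H" "\<And>z. z \<in> M \<Longrightarrow> H z \<in> C z"
  proof (rule smooth_selection[OF M, of C m])
    fix z assume z: "z \<in> M"
    show "closed (C z)" "convex (C z)" by (auto simp: C_def)
    \<comment> \<open>Local selections: the constant \<open>a\<close> before time 0, the projection
      \<open>fst\<close> after time 1, and otherwise the constant \<open>G z\<close>, which stays in
      the moving ball near \<open>z\<close> by continuity of \<open>G\<close> and
      \<open>r\<close>.\<close>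
    consider "snd z < 0" | "snd z > 1" | "0 \<le> snd z" "snd z \<le> 1" by linarith
    then show "\<exists>e>0. \<exists>p. Ck m UNIV p \<and> (\<forall>x\<in>ball z e \<inter> M. p x \<in> C x)"
    proof cases
      case 1
      have "a \<in> C x" if "x \<in> ball z (- snd z) \<inter> M" for x
        using dsnd[of x z "- snd z"] that Ga[of x] CG[of x] by auto
      then show ?thesis using 1 by (intro exI[of _ "- snd z"] conjI exI[of _ "\<lambda>_. a"] Ck_const) auto
    next
      case 2
      have "fst x \<in> C x" if "x \<in> ball z (snd z - 1) \<inter> M" for x
        using dsnd[of x z "snd z - 1"] that Gx[of x] CG[of x] by auto
      then show ?thesis
        using 2 by (intro exI[of _ "snd z - 1"] conjI exI[of _ fst] Ck_linear bounded_linear_fst) auto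
    next
      case 3
      have "continuous_on M (\<lambda>x. r (G x) - dist (G x) (G z))"
        by (intro continuous_intros cG continuous_on_compose2[OF cr cG]) auto
      then have "isCont (\<lambda>x. r (G x) - dist (G x) (G z)) z"
        using z M continuous_on_eq_continuous_at by blast
      then have "((\<lambda>x. r (G x) - dist (G x) (G z)) \<longlongrightarrow> r (G z) - dist (G z) (G z)) (nhds z)"
        unfolding isCont_def tendsto_at_iff_tendsto_nhds[of "\<lambda>x. r (G x) - dist (G x) (G z)" z] .
      then have "\<forall>\<^sub>F x in nhds z. 0 < r (G x) - dist (G x) (G z)"
        using rpos[OF G\<Omega>[OF z]] by (intro order_tendstoD) auto
      then obtain d where d: "d > 0" "\<And>x. dist x z < d \<Longrightarrow> 0 < r (G x) - dist (G x) (G z)"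
        unfolding eventually_nhds_metric by blast
      \<comment> \<open>Radius at most 1 keeps the time strictly between -1 and 2, where
        \<open>C x\<close> is a ball.\<close>
      have "G z \<in> C x" if "x \<in> ball z (min d 1) \<inter> M" for x
        using d(2)[of x] dsnd[of x z 1] that 3 by (auto simp: C_def dist_commute)
      then show ?thesis using d(1) by (intro exI[of _ "min d 1"] conjI exI[of _ "\<lambda>_. G z"] Ck_const) auto
    qed
  qed blast
  have CM: "C z \<subseteq> \<Omega>" if "z \<in> M" for z
    using rcball[OF G\<Omega>[OF that]] Ga[OF that] Gx[OF that] G\<Omega>[OF that] by (auto simp: C_def split: if_splits)
  show thesis
  proof (rule that[of H a])
    show "Ck m (\<Omega> \<times> UNIV) H" using H(1) by (simp add: M_def)
  next
    fix x t assume x: "x \<in> \<Omega>"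
    then have z: "(x, t) \<in> M" by (simp add: M_def)
    show "H (x, t) \<in> \<Omega>" using H(2)[OF z] CM[OF z] by auto
    show "t \<le> -1 \<Longrightarrow> H (x, t) = a" "2 \<le> t \<Longrightarrow> H (x, t) = x"
      using H(2)[OF z] by (auto simp: C_def)
  qed
qed

subsection \<open>The Poincare lemma on contractible open sets\<close>

type_synonym 'n pt = "real ^ 'n"
type_synonym 'n cyl = "(real ^ 'n) \<times> real"

definition sp_dir :: "'n::finite \<Rightarrow> 'n cyl" where
  "sp_dir i = (axis i 1, 0)"

definition tm_dir :: "'n::finite cyl" where
  "tm_dir = (0, 1)"

lemma sp_dir_tm_dir_Basis: "sp_dir i \<in> Basis" "tm_dir \<in> Basis"
  by (auto simp: sp_dir_def tm_dir_def Basis_prod_def Basis_vec_def)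

section \<open>Products of pulled-back one-forms on the cylinder\<close>

definition one_covec :: "('n::{finite,linorder} \<Rightarrow> real) \<Rightarrow> 'n covec" where
  "one_covec a = (\<Sum>i\<in>UNIV. a i *\<^sub>R dx i)"

lemma one_covec_wedge: "one_covec a \<and>\<^sub>w b = (\<Sum>i\<in>UNIV. a i *\<^sub>R (dx i \<and>\<^sub>w b))"
  by (simp add: one_covec_def linear_sum[OF linear_wedge_flip] linear_scale[OF linear_wedge_flip])

lemma dx_one_covec_anticommute: "dx i \<and>\<^sub>w one_covec a \<and>\<^sub>w b = - (one_covec a \<and>\<^sub>w dx i \<and>\<^sub>w b)"
  unfolding one_covec_wedge wedge_linear_simps sum_negf[symmetric]
  by (intro sum.cong refl) (subst wedge_dx_anticommute, simp)

lemma one_covec_anticommute: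
  "one_covec a \<and>\<^sub>w one_covec b \<and>\<^sub>w c = - (one_covec b \<and>\<^sub>w one_covec a \<and>\<^sub>w c)"
  unfolding one_covec_wedge[of a] dx_one_covec_anticommute wedge_linear_simps
  by (simp add: sum_negf)

lemma covecs_one_covec: "a \<in> covecs k \<Longrightarrow> one_covec v \<and>\<^sub>w a \<in> covecs (Suc k)"
  unfolding one_covec_wedge
  by (intro subspace_sum subspace_covecs subspace_scale covecs_wedge_dx)

lemma bounded_bilinear_wedge: "bounded_bilinear wedge"
  unfolding bilinear_conv_bounded_bilinear[symmetric] bilinear_def
  using linear_wedge linear_wedge_flip by blast

definition sp_d :: "('n::{finite,linorder} cyl \<Rightarrow> 'n covec) \<Rightarrow> 'n cyl \<Rightarrow> 'n covec" where
  "sp_d f z = (\<Sum>i\<in>UNIV. dx i \<and>\<^sub>w dirD (sp_dir i) f z)"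

definition grad_covec :: "('n::{finite,linorder} cyl \<Rightarrow> 'n pt) \<Rightarrow> 'n \<Rightarrow> 'n cyl \<Rightarrow> 'n covec" where
  "grad_covec H j z = one_covec (\<lambda>i. dirD (sp_dir i) H z $ j)"

text \<open>A form \<open>w + dt \<and> c\<close> on \<open>\<real>\<^sup>n \<times> \<real>\<close> is represented by the pair \<open>(w, c)\<close>; then \<open>cyl_step H z j\<close> is
  multiplication by \<open>H\<^sup>*dx\<^sub>j = d\<^sub>xH\<^sub>j + \<partial>\<^sub>tH\<^sub>j dt\<close> from the left, and \<open>cyl_word H [j\<^sub>1,\<dots>,j\<^sub>k]\<close> is
  \<open>H\<^sup>*(dx\<^sub>j\<^sub>1 \<and> \<dots> \<and> dx\<^sub>j\<^sub>k)\<close>.\<close>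

definition cyl_step :: "('n::{finite,linorder} cyl \<Rightarrow> 'n pt) \<Rightarrow> 'n cyl \<Rightarrow> 'n
    \<Rightarrow> 'n covec \<times> 'n covec \<Rightarrow> 'n covec \<times> 'n covec" where
  "cyl_step H z j p = (grad_covec H j z \<and>\<^sub>w fst p,
     (dirD tm_dir H z $ j) *\<^sub>R fst p - grad_covec H j z \<and>\<^sub>w snd p)"

definition cyl_word :: "('n::{finite,linorder} cyl \<Rightarrow> 'n pt) \<Rightarrow> 'n list
    \<Rightarrow> 'n cyl \<Rightarrow> 'n covec \<times> 'n covec" where
  "cyl_word H l z = foldr (cyl_step H z) l (axis {} 1, 0)"

lemma cyl_word_simps:
  "cyl_word H [] z = (axis {} 1, 0)"
  "cyl_word H (j # l) z = cyl_step H z j (cyl_word H l z)"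
  by (simp_all add: cyl_word_def)

lemma linear_cyl_step: "linear (cyl_step H z j)"
  by (rule linearI) (simp_all add: cyl_step_def wedge_linear_simps algebra_simps)

text \<open>These operators are left multiplications by one-forms on the cylinder. In the second
  component the mixed terms cancel in pairs, thanks to the minus sign from moving dt past a spatial
  one-form.\<close>

lemma cyl_step_anticommute: "cyl_step H z i (cyl_step H z j p) = - cyl_step H z j (cyl_step H z i p)"
proof -
  have "grad_covec H i z \<and>\<^sub>w grad_covec H j z \<and>\<^sub>w q = - (grad_covec H j z \<and>\<^sub>w grad_covec H i z \<and>\<^sub>w q)" for q
    unfolding grad_covec_def by (rule one_covec_anticommute)
  from this[of "fst p"] this[of "snd p"] show ?thesis
    by (simp add: cyl_step_def wedge_linear_simps)
qed

lemma covecs_cyl_word: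
  "fst (cyl_word H l z) \<in> covecs (length l) \<and> snd (cyl_word H l z) \<in> covecs (length l - 1)"
proof (induction l)
  case Nil
  then show ?case by (auto simp: cyl_word_simps covecs_def axis_def)
next
  case (Cons j l)
  have "grad_covec H j z \<and>\<^sub>w snd (cyl_word H l z) \<in> covecs (length l)"
  \<comment> \<open>For the empty word \<open>length l - 1\<close> is truncated to 0 and the degree
    count would be off by one, but there the second component is 0.\<close>
  proof (cases l)
    case Nil
    then show ?thesis by (simp add: cyl_word_simps wedge_0 subspace_0[OF subspace_covecs])
  next
    case Cons': (Cons a l')
    then show ?thesis using Cons.IH covecs_one_covec[of "snd (cyl_word H l z)" "length l - 1"]
      by (simp add: grad_covec_def)
  qed
  then show ?case
    using Cons.IH by (auto simp: cyl_word_simps cyl_step_def grad_covec_def intro!: covecs_one_covec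
        subspace_diff[OF subspace_covecs] subspace_scale[OF subspace_covecs])
qed

lemma dirD_differentiable:
  assumes "Ck 2 M f" "z \<in> M" "b \<in> Basis"
  shows "dirD b f differentiable at z"
  using assms by (simp add: numeral_2_eq_2)

lemma Ck_dirD_nth:
  assumes "open M" "Ck 2 M H" "b \<in> Basis"
  shows "Ck 1 M (\<lambda>z. dirD b H z $ j)"
proof -
  have "Ck 1 M (dirD b H)" using assms Ck_SucD(2)[of 1 M H b] by (simp add: numeral_2_eq_2)
  then show ?thesis by (rule Ck_linear_comp[OF bounded_linear_vec_nth assms(1)])
qed

lemma Ck_grad_covec:
  assumes "open M" "Ck 2 M H"
  shows "Ck 1 M (grad_covec H j)"
  unfolding grad_covec_def one_covec_def
  by (intro Ck_sum[OF assms(1)] Ck_linear_comp[OF bounded_linear_scaleR_left assms(1)]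
      Ck_dirD_nth[OF assms] sp_dir_tm_dir_Basis)

lemma Ck_cyl_word:
  assumes "open M" "Ck 2 M H"
  shows "Ck 1 M (\<lambda>z. fst (cyl_word H l z)) \<and> Ck 1 M (\<lambda>z. snd (cyl_word H l z))"
proof (induction l)
  case Nil
  show ?case unfolding cyl_word_simps fst_conv snd_conv by (intro conjI Ck_const)
next
  case (Cons j l)
  note g = Ck_bilinear[OF bounded_bilinear_wedge assms(1) Ck_grad_covec[OF assms]]
  have s: "Ck 1 M (\<lambda>z. (dirD tm_dir H z $ j) *\<^sub>R fst (cyl_word H l z))"
    using Cons by (intro Ck_bilinear[OF bounded_bilinear_scaleR assms(1)] Ck_dirD_nth[OF assms]
        sp_dir_tm_dir_Basis) auto
  have "Ck 1 M (\<lambda>z. (dirD tm_dir H z $ j) *\<^sub>R fst (cyl_word H l z) + - (grad_covec H j z \<and>\<^sub>w snd (cyl_word H l z)))"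
    using Cons by (intro Ck_add[OF assms(1)] s
        Ck_linear_comp[OF bounded_linear_minus[OF bounded_linear_ident] assms(1)] g) auto
  moreover have "Ck 1 M (\<lambda>z. grad_covec H j z \<and>\<^sub>w fst (cyl_word H l z))"
    using Cons by (intro g) auto
  ultimately show ?case by (simp add: cyl_word_simps cyl_step_def)
qed

lemma dirD_grad_covec:
  assumes "open M" "z \<in> M" "Ck 2 M H"
  shows "dirD v (grad_covec H j) z = one_covec (\<lambda>i. dirD v (dirD (sp_dir i) H) z $ j)"
proof (rule dirD_eq)
  have "dirD (sp_dir i) H differentiable at z" for i
    by (rule dirD_differentiable[OF assms(3,2) sp_dir_tm_dir_Basis(1)])
  then show "(grad_covec H j has_derivative
      (\<lambda>v. one_covec (\<lambda>i. dirD v (dirD (sp_dir i) H) z $ j))) (at z)"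
    unfolding grad_covec_def[abs_def] one_covec_def
    by (intro has_derivative_sum has_derivative_scaleR_left
        bounded_linear.has_derivative[OF bounded_linear_vec_nth] dirD_works)
qed

text \<open>In terms of pairs, \<open>w + dt \<and> c\<close> is closed iff \<open>d\<^sub>xw = 0\<close> and \<open>\<partial>\<^sub>tw = d\<^sub>xc\<close>.\<close>

lemma cyl_word_closed:
  assumes M: "open M" "z \<in> M" and H: "Ck 2 M H"
  shows "sp_d (\<lambda>z. fst (cyl_word H l z)) z = 0 \<and>
    dirD tm_dir (\<lambda>z. fst (cyl_word H l z)) z = sp_d (\<lambda>z. snd (cyl_word H l z)) z"
proof (induction l)
  case Nil
  show ?case by (simp add: cyl_word_simps sp_d_def wedge_0 dirD_const)
next
  case (Cons j l)
  define W where "W = (\<lambda>z. fst (cyl_word H l z))"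
  define C where "C = (\<lambda>z. snd (cyl_word H l z))"
  define \<theta> where "\<theta> = grad_covec H j"
  define s where "s = (\<lambda>z. dirD tm_dir H z $ j)"
  have IH: "sp_d W z = 0" "dirD tm_dir W z = sp_d C z"
    using Cons.IH by (simp_all add: W_def C_def)
  have dW: "W differentiable at z" "C differentiable at z"
    using Ck_cyl_word[OF M(1) H, of l] M(2) by (auto simp: W_def C_def)
  have d\<theta>: "\<theta> differentiable at z" using Ck_grad_covec[OF M(1) H] M(2) by (simp add: \<theta>_def)
  have ds: "s differentiable at z"
    using Ck_dirD_nth[OF M(1) H sp_dir_tm_dir_Basis(2)] M(2) by (simp add: s_def)
  have D1: "dirD v (\<lambda>z. \<theta> z \<and>\<^sub>w f z) z = \<theta> z \<and>\<^sub>w dirD v f z + dirD v \<theta> z \<and>\<^sub>w f z"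
    if "f differentiable at z" for f v
    by (rule dirD_eq) (rule bounded_bilinear.FDERIV[OF bounded_bilinear_wedge dirD_works[OF d\<theta>] dirD_works[OF that]])
  have D2: "dirD v (\<lambda>z. s z *\<^sub>R W z - \<theta> z \<and>\<^sub>w C z) z
      = s z *\<^sub>R dirD v W z + dirD v s z *\<^sub>R W z - (\<theta> z \<and>\<^sub>w dirD v C z + dirD v \<theta> z \<and>\<^sub>w C z)" for v
    by (rule dirD_eq) (intro has_derivative_diff has_derivative_scaleR dirD_works ds dW
        bounded_bilinear.FDERIV[OF bounded_bilinear_wedge] d\<theta>)
  have sym: "dirD u (dirD v H) z = dirD v (dirD u H) z" if "u \<in> Basis" "v \<in> Basis" for u v
    using dirD_commute[OF M H that] .
  \<comment> \<open>The spatial gradient of a component of \<open>H\<close> is closed in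
    \<open>x\<close>, by symmetry of the second derivatives.\<close>
  have closed: "(\<Sum>k\<in>UNIV. dx k \<and>\<^sub>w dirD (sp_dir k) \<theta> z \<and>\<^sub>w a) = 0" for a
  proof -
    have "(\<Sum>k\<in>UNIV. dx k \<and>\<^sub>w dirD (sp_dir k) \<theta> z \<and>\<^sub>w a)
        = (\<Sum>k\<in>UNIV. \<Sum>i\<in>UNIV. (dirD (sp_dir k) (dirD (sp_dir i) H) z $ j) *\<^sub>R (dx k \<and>\<^sub>w dx i \<and>\<^sub>w a))"
      by (simp add: \<theta>_def dirD_grad_covec[OF M H] one_covec_wedge wedge_linear_simps)
    also have "\<dots> = 0"
      by (rule antisymmetric_sum_0)
        (subst wedge_dx_anticommute, subst sym[OF sp_dir_tm_dir_Basis(1) sp_dir_tm_dir_Basis(1)], simp)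
    finally show ?thesis .
  qed
  have anti: "dx k \<and>\<^sub>w \<theta> z \<and>\<^sub>w a = - (\<theta> z \<and>\<^sub>w dx k \<and>\<^sub>w a)" for k a
    unfolding \<theta>_def grad_covec_def by (rule dx_one_covec_anticommute)
  \<comment> \<open>The time derivative commutes with the spatial gradient: differentiating the
    gradient of a component of \<open>H\<close> in time gives the spatial gradient of
    \<open>s\<close>.\<close>
  have time: "dirD tm_dir \<theta> z \<and>\<^sub>w a = (\<Sum>k\<in>UNIV. dirD (sp_dir k) s z *\<^sub>R (dx k \<and>\<^sub>w a))" for a
  proof -
    have "dirD tm_dir H differentiable at z"
      by (rule dirD_differentiable[OF H M(2) sp_dir_tm_dir_Basis(2)])
    then have "dirD v s z = dirD v (dirD tm_dir H) z $ j" for v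
      unfolding s_def
      by (intro dirD_eq bounded_linear.has_derivative[OF bounded_linear_vec_nth] dirD_works)
    then show ?thesis
      by (simp add: \<theta>_def dirD_grad_covec[OF M H] one_covec_wedge sym[OF sp_dir_tm_dir_Basis(2) sp_dir_tm_dir_Basis(1)])
  qed
  have Wc: "(\<lambda>z. fst (cyl_word H (j # l) z)) = (\<lambda>z. \<theta> z \<and>\<^sub>w W z)"
    "(\<lambda>z. snd (cyl_word H (j # l) z)) = (\<lambda>z. s z *\<^sub>R W z - \<theta> z \<and>\<^sub>w C z)"
    by (simp_all add: cyl_word_simps cyl_step_def \<theta>_def s_def W_def C_def)
  have th: "(\<Sum>k\<in>UNIV. dx k \<and>\<^sub>w \<theta> z \<and>\<^sub>w dirD (sp_dir k) f z) = - (\<theta> z \<and>\<^sub>w sp_d f z)" for f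
    by (simp add: anti sum_negf sp_d_def wedge_linear_simps)
  have "sp_d (\<lambda>z. \<theta> z \<and>\<^sub>w W z) z = - (\<theta> z \<and>\<^sub>w sp_d W z)"
    unfolding sp_d_def[of "\<lambda>z. \<theta> z \<and>\<^sub>w W z"]
    by (simp add: D1[OF dW(1)] wedge_linear_simps sum.distrib closed th)
  then have 1: "sp_d (\<lambda>z. \<theta> z \<and>\<^sub>w W z) z = 0" by (simp add: IH(1) wedge_0)
  have "sp_d (\<lambda>z. s z *\<^sub>R W z - \<theta> z \<and>\<^sub>w C z) z
      = s z *\<^sub>R sp_d W z + dirD tm_dir \<theta> z \<and>\<^sub>w W z + \<theta> z \<and>\<^sub>w sp_d C z"
    unfolding sp_d_def[of "\<lambda>z. s z *\<^sub>R W z - \<theta> z \<and>\<^sub>w C z"]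
    by (simp add: D2 wedge_linear_simps sum.distrib sum_subtractf closed th time)
      (simp add: sp_d_def scaleR_sum_right)
  then have 2: "dirD tm_dir (\<lambda>z. \<theta> z \<and>\<^sub>w W z) z = sp_d (\<lambda>z. s z *\<^sub>R W z - \<theta> z \<and>\<^sub>w C z) z"
    by (simp add: D1[OF dW(1)] IH)
  show ?case unfolding Wc using 1 2 by blast
qed

text \<open>\<open>H\<^sup>*\<omega> = cyl_form H \<omega> + dt \<and> cyl_dt_form H \<omega>\<close>\<close>

definition cyl_form :: "('n::{finite,linorder} cyl \<Rightarrow> 'n pt) \<Rightarrow> 'n form
    \<Rightarrow> 'n cyl \<Rightarrow> 'n covec" where
  "cyl_form H \<omega> z = (\<Sum>J\<in>UNIV. (\<omega> (H z) $ J) *\<^sub>R fst (cyl_word H (sorted_list_of_set J) z))"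

definition cyl_dt_form :: "('n::{finite,linorder} cyl \<Rightarrow> 'n pt) \<Rightarrow> 'n form
    \<Rightarrow> 'n cyl \<Rightarrow> 'n covec" where
  "cyl_dt_form H \<omega> z = (\<Sum>J\<in>UNIV. (\<omega> (H z) $ J) *\<^sub>R snd (cyl_word H (sorted_list_of_set J) z))"

lemma dirD_vec_expand:
  fixes f :: "real ^ 'n \<Rightarrow> 'b::real_normed_vector"
  assumes "f differentiable at y"
  shows "dirD u f y = (\<Sum>m\<in>UNIV. (u $ m) *\<^sub>R dirD (axis m 1) f y)"
proof -
  have "dirD u f y = dirD (\<Sum>m\<in>UNIV. (u $ m) *\<^sub>R axis m 1) f y"
    using basis_expansion[of u] by (simp add: scalar_mult_eq_scaleR)
  also have "\<dots> = (\<Sum>m\<in>UNIV. (u $ m) *\<^sub>R dirD (axis m 1) f y)"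
    by (simp add: linear_sum[OF dirD_linear[OF assms]] linear_scale[OF dirD_linear[OF assms]])
  finally show ?thesis .
qed

lemma Ck_cyl_form:
  assumes "open M" "Ck 2 M H" "H ` M \<subseteq> \<Omega>" "Ck 1 \<Omega> \<omega>"
  shows "Ck 1 M (cyl_form H \<omega>)" "Ck 1 M (cyl_dt_form H \<omega>)"
proof -
  have "Ck 1 M H" using assms(2) by (rule Ck_mono[rotated]) simp
  then have "Ck 1 M (\<lambda>z. \<omega> (H z) $ J)" for J
    by (rule Ck_linear_comp[OF bounded_linear_vec_nth assms(1) Ck_compose[OF assms(1,3) _ assms(4)]])
  then show "Ck 1 M (cyl_form H \<omega>)" "Ck 1 M (cyl_dt_form H \<omega>)"
    unfolding cyl_form_def[abs_def] cyl_dt_form_def[abs_def]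
    using Ck_cyl_word[OF assms(1,2)]
    by (intro Ck_sum[OF assms(1)] Ck_bilinear[OF bounded_bilinear_scaleR assms(1)]; blast)+
qed

text \<open>The difference of the two sides is the dt-component of the pullback of
  \<open>ext_d \<omega>\<close>, and that form vanishes at \<open>H z\<close>. Only first
  derivatives of \<open>\<omega>\<close> enter, because the words themselves are closed by
  \<open>cyl_word_closed\<close>.\<close>

lemma cyl_form_closed:
  fixes H :: "'n::{finite,linorder} cyl \<Rightarrow> 'n pt"
  assumes M: "open M" "z \<in> M" and H: "Ck 2 M H" "H ` M \<subseteq> \<Omega>" and \<omega>: "Ck 1 \<Omega> \<omega>"
    and closed: "ext_d \<omega> (H z) = 0"
  shows "dirD tm_dir (cyl_form H \<omega>) z = sp_d (cyl_dt_form H \<omega>) z"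
proof -
  let ?W = "\<lambda>J z. fst (cyl_word H (sorted_list_of_set J) z)"
  let ?C = "\<lambda>J z. snd (cyl_word H (sorted_list_of_set J) z)"
  define P where "P = (\<lambda>m J. dirD (axis m 1) \<omega> (H z) $ J)"
  have dH: "H differentiable at z" using H(1) M(2) by (simp add: numeral_2_eq_2)
  have d\<omega>: "\<omega> differentiable at (H z)" using \<omega> H(2) M(2) by auto
  have dWC: "?W J differentiable at z" "?C J differentiable at z" for J
    using Ck_cyl_word[OF M(1) H(1)] M(2) by auto
  have dcomp: "((\<lambda>z. \<omega> (H z) $ J) has_derivative (\<lambda>v. \<Sum>m\<in>UNIV. (dirD v H z $ m) * P m J)) (at z)" for J
    using bounded_linear.has_derivative[OF bounded_linear_vec_nth dirD_compose[OF dH d\<omega>], of J]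
    by (simp add: dirD_vec_expand[OF d\<omega>, of "dirD v H z" for v] P_def)
  have dW: "dirD v (cyl_form H \<omega>) z = (\<Sum>J\<in>UNIV. (\<omega> (H z) $ J) *\<^sub>R dirD v (?W J) z
      + (\<Sum>m\<in>UNIV. (dirD v H z $ m) * P m J) *\<^sub>R ?W J z)" for v
    unfolding cyl_form_def[abs_def]
    by (rule dirD_eq) (intro has_derivative_sum has_derivative_scaleR dcomp dirD_works dWC)
  have dC: "dirD v (cyl_dt_form H \<omega>) z = (\<Sum>J\<in>UNIV. (\<omega> (H z) $ J) *\<^sub>R dirD v (?C J) z
      + (\<Sum>m\<in>UNIV. (dirD v H z $ m) * P m J) *\<^sub>R ?C J z)" for v
    unfolding cyl_dt_form_def[abs_def]
    by (rule dirD_eq) (intro has_derivative_sum has_derivative_scaleR dcomp dirD_works dWC)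
  have 1: "(\<Sum>k\<in>UNIV. dx k \<and>\<^sub>w ((\<Sum>m\<in>UNIV. (dirD (sp_dir k) H z $ m) * P m J) *\<^sub>R ?C J z))
      = (\<Sum>m\<in>UNIV. P m J *\<^sub>R (grad_covec H m z \<and>\<^sub>w ?C J z))" for J
    unfolding grad_covec_def one_covec_wedge wedge_linear_simps scaleR_sum_left scaleR_sum_right
    by (subst sum.swap) (simp add: mult.commute)
  have "sp_d (cyl_dt_form H \<omega>) z
      = (\<Sum>J\<in>UNIV. (\<omega> (H z) $ J) *\<^sub>R sp_d (?C J) z + (\<Sum>m\<in>UNIV. P m J *\<^sub>R (grad_covec H m z \<and>\<^sub>w ?C J z)))"
  proof -
    have "sp_d (cyl_dt_form H \<omega>) z = (\<Sum>k\<in>UNIV. \<Sum>J\<in>UNIV. (\<omega> (H z) $ J) *\<^sub>R (dx k \<and>\<^sub>w dirD (sp_dir k) (?C J) z)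
      + dx k \<and>\<^sub>w ((\<Sum>m\<in>UNIV. (dirD (sp_dir k) H z $ m) * P m J) *\<^sub>R ?C J z))"
      unfolding sp_d_def[of "cyl_dt_form H \<omega>"] dC wedge_sum_right wedge_add_right
      unfolding wedge_scaleR_right ..
    also have "\<dots> = (\<Sum>J\<in>UNIV. (\<omega> (H z) $ J) *\<^sub>R sp_d (?C J) z
      + (\<Sum>k\<in>UNIV. dx k \<and>\<^sub>w ((\<Sum>m\<in>UNIV. (dirD (sp_dir k) H z $ m) * P m J) *\<^sub>R ?C J z)))"
      by (subst sum.swap) (simp only: sum.distrib sp_d_def scaleR_sum_right)
    finally show ?thesis unfolding 1 .
  qed
  moreover have "dirD tm_dir (cyl_form H \<omega>) z = (\<Sum>J\<in>UNIV. (\<omega> (H z) $ J) *\<^sub>R sp_d (?C J) z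
      + (\<Sum>m\<in>UNIV. P m J *\<^sub>R ((dirD tm_dir H z $ m) *\<^sub>R ?W J z)))"
    unfolding dW using cyl_word_closed[OF M H(1)]
    by (simp add: scaleR_sum_left mult.commute)
  \<comment> \<open>Derivatives of words have cancelled. What remains comes from differentiating the
    coefficients along \<open>H\<close>, and each \<open>P m J\<close> now multiplies the dt-part of
    a word extended on the left by \<open>m\<close>.\<close>
  ultimately have "dirD tm_dir (cyl_form H \<omega>) z - sp_d (cyl_dt_form H \<omega>) z
      = (\<Sum>J\<in>UNIV. \<Sum>m\<in>UNIV. P m J *\<^sub>R snd (cyl_step H z m (cyl_word H (sorted_list_of_set J) z)))"
    by (simp add: sum_subtractf[symmetric] cyl_step_def scaleR_diff_right)
  also have "\<dots> = (\<Sum>m\<in>UNIV. \<Sum>J\<in>UNIV. P m J *\<^sub>R (if m \<in> J then 0 else shuffle_sign {m} J *\<^sub>R ?C (insert m J) z))"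
  proof (subst sum.swap, intro sum.cong refl)
    fix m J
    show "P m J *\<^sub>R snd (cyl_step H z m (cyl_word H (sorted_list_of_set J) z))
      = P m J *\<^sub>R (if m \<in> J then 0 else shuffle_sign {m} J *\<^sub>R ?C (insert m J) z)"
      unfolding cyl_word_def
      by (subst foldr_insert_anticommute[OF linear_cyl_step cyl_step_anticommute]) simp
  qed
  \<comment> \<open>With \<open>K = insert m J\<close> the sign produced by sorting is the sign in
    the coefficient at \<open>K\<close> of a wedge with \<open>dx m\<close>.\<close>
  also have "\<dots> = (\<Sum>m\<in>UNIV. \<Sum>K\<in>UNIV. ((dx m \<and>\<^sub>w dirD (axis m 1) \<omega> (H z)) $ K) *\<^sub>R ?C K z)"
  proof (rule sum.cong[OF refl])
    fix m :: 'n
    have "(\<Sum>J\<in>UNIV. P m J *\<^sub>R (if m \<in> J then 0 else shuffle_sign {m} J *\<^sub>R ?C (insert m J) z))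
        = (\<Sum>J\<in>{J. m \<notin> J}. P m J *\<^sub>R (shuffle_sign {m} J *\<^sub>R ?C (insert m J) z))"
      by (rule sum.mono_neutral_cong_right) auto
    also have "\<dots> = (\<Sum>K\<in>{K. m \<in> K}. (shuffle_sign {m} (K - {m}) * P m (K - {m})) *\<^sub>R ?C K z)"
      by (rule sum.reindex_bij_witness[of _ "\<lambda>K. K - {m}" "insert m"]) (auto simp: insert_absorb mult.commute)
    also have "\<dots> = (\<Sum>K\<in>UNIV. ((dx m \<and>\<^sub>w dirD (axis m 1) \<omega> (H z)) $ K) *\<^sub>R ?C K z)"
      by (rule sum.mono_neutral_cong_left) (auto simp: wedge_dx_nth P_def)
    finally show "(\<Sum>J\<in>UNIV. P m J *\<^sub>R (if m \<in> J then 0 else shuffle_sign {m} J *\<^sub>R ?C (insert m J) z))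
        = (\<Sum>K\<in>UNIV. ((dx m \<and>\<^sub>w dirD (axis m 1) \<omega> (H z)) $ K) *\<^sub>R ?C K z)" .
  qed
  also have "\<dots> = (\<Sum>K\<in>UNIV. (ext_d \<omega> (H z) $ K) *\<^sub>R ?C K z)"
    by (subst sum.swap) (simp add: ext_d_dirD scaleR_sum_left)
  also have "\<dots> = 0" by (simp add: closed)
  finally show ?thesis by simp
qed

text \<open>Here the spatial part of each factor is \<open>dx j\<close> itself, and prefixing the
  smallest index to a sorted word passes no smaller letter, so the sign is 1.\<close>

lemma fst_cyl_word_id:
  assumes "\<And>i. dirD (sp_dir i) H z = axis i 1" "sorted l" "distinct l"
  shows "fst (cyl_word H l z) = axis (set l) 1"
  using assms(2,3)
proof (induction l)
  case Nil
  then show ?case by (simp add: cyl_word_simps)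
next
  case (Cons j l)
  have "one_covec (\<lambda>i. axis i 1 $ j) = dx j"
    by (simp add: one_covec_def axis_def if_distrib[of "\<lambda>c. c *\<^sub>R _"] cong: if_cong)
  then have "fst (cyl_word H (j # l) z) = dx j \<and>\<^sub>w axis (set l) 1"
    using Cons assms(1) by (simp add: cyl_word_simps cyl_step_def grad_covec_def)
  also have "\<dots> = axis (insert j (set l)) 1"
  proof -
    have none: "{b \<in> set l. b < j} = {}" using Cons.prems by auto
    have "shuffle_sign {j} (set l) = 1"
      unfolding shuffle_sign_singleton none by simp
    moreover have j: "j \<notin> set l" using Cons.prems by simp
    moreover have "j \<in> K \<Longrightarrow> K - {j} = set l \<longleftrightarrow> K = insert j (set l)" for K using j by auto
    ultimately have "(dx j \<and>\<^sub>w axis (set l) 1) $ K = axis (insert j (set l)) 1 $ K" for K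
      by (auto simp: wedge_dx_nth axis_def)
    then show ?thesis by (simp add: vec_eq_iff)
  qed
  finally show ?case by simp
qed

lemma cyl_form_id:
  assumes "open N" "z \<in> N" "\<And>y. y \<in> N \<Longrightarrow> H y = fst y"
  shows "cyl_form H \<omega> z = \<omega> (fst z)"
proof -
  have "dirD (sp_dir i) H z = axis i 1" for i
    using dirD_cong[OF assms, where v = "sp_dir i"]
      dirD_eq[OF bounded_linear_imp_has_derivative[OF bounded_linear_fst], of "sp_dir i" z]
    by (simp add: sp_dir_def)
  from fst_cyl_word_id[OF this]
  have "cyl_form H \<omega> z = (\<Sum>J\<in>UNIV. (\<omega> (fst z) $ J) *\<^sub>R axis J 1)"
    using assms by (simp add: cyl_form_def)
  then show ?thesis using basis_expansion[of "\<omega> (fst z)"] by (simp add: scalar_mult_eq_scaleR)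
qed

text \<open>A nonempty word contains a spatial gradient of \<open>H\<close>, which is 0. The empty
  word is 1, so the coefficient at \<open>{}\<close> has to vanish separately; forms of positive
  degree satisfy this.\<close>

lemma cyl_form_const:
  assumes "open N" "z \<in> N" "\<And>y. y \<in> N \<Longrightarrow> H y = a" "\<omega> a $ {} = 0"
  shows "cyl_form H \<omega> z = 0"
proof -
  have "dirD v H z = 0" for v
    using dirD_cong[OF assms(1-3), where v = v] dirD_eq[OF has_derivative_const, of v a z] by simp
  then have "fst (cyl_word H (j # l) z) = 0" for j l
    by (simp add: cyl_word_simps cyl_step_def grad_covec_def one_covec_def wedge_def vec_eq_iff)
  then have "fst (cyl_word H l z) = 0" if "l \<noteq> []" for l
    using that by (cases l) auto
  then have "(\<omega> (H z) $ J) *\<^sub>R fst (cyl_word H (sorted_list_of_set J) z) = 0" for J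
    using assms(2-4) by (cases "J = {}") auto
  then show ?thesis unfolding cyl_form_def by (intro sum.neutral ballI)
qed

lemma Ck_integral_cylinder:
  fixes f :: "'a::euclidean_space \<times> real \<Rightarrow> 'b::euclidean_space"
  assumes \<Omega>: "open \<Omega>" and f: "Ck 1 (\<Omega> \<times> UNIV) f"
  shows "Ck 1 \<Omega> (\<lambda>x. integral {p..q} (\<lambda>t. f (x, t)))"
    and "x \<in> \<Omega> \<Longrightarrow> v \<in> Basis \<Longrightarrow> dirD v (\<lambda>x. integral {p..q} (\<lambda>t. f (x, t))) x
      = integral {p..q} (\<lambda>t. dirD (v, 0) f (x, t))"
proof -
  have df: "f differentiable at (x, t)" if "x \<in> \<Omega>" for x t using f that by auto
  \<comment> \<open>The Leibniz rule integrates the derivative as an element of the normed space of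
    bounded linear maps; its continuity there can be checked on basis vectors.\<close>
  define L where "L = (\<lambda>x t. Blinfun (\<lambda>v. dirD (v, 0) f (x, t)))"
  have slice: "((\<lambda>x. f (x, t)) has_derivative (\<lambda>v. dirD (v, 0) f (x, t))) (at x)" if "x \<in> \<Omega>" for x t
  proof -
    have "((\<lambda>x. (x, t)) has_derivative (\<lambda>v. (v, 0))) (at x)"
      by (auto intro!: derivative_eq_intros)
    from diff_chain_at[OF this dirD_works[OF df[OF that]]] show ?thesis by (simp add: o_def)
  qed
  have L: "blinfun_apply (L x t) = (\<lambda>v. dirD (v, 0) f (x, t))" if "x \<in> \<Omega>" for x t
    unfolding L_def using has_derivative_bounded_linear[OF slice[OF that]] by (rule bounded_linear_Blinfun_apply)
  have cf: "continuous_on (\<Omega> \<times> UNIV) f" using f by (rule Ck_imp_continuous_on)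
  have cD: "continuous_on (\<Omega> \<times> UNIV) (\<lambda>z. dirD (v, 0) f z)" if "v \<in> Basis" for v
    using f that by (auto simp: Basis_prod_def)
  have cL: "continuous_on (\<Omega> \<times> cbox p q) (\<lambda>(x, t). L x t)"
  proof (rule continuous_on_blinfun_componentwise)
    fix i :: 'a assume "i \<in> Basis"
    then have "continuous_on (\<Omega> \<times> cbox p q) (\<lambda>z. dirD (i, 0) f z)"
      using cD continuous_on_subset by blast
    then show "continuous_on (\<Omega> \<times> cbox p q) (\<lambda>z. blinfun_apply (case z of (x, t) \<Rightarrow> L x t) i)"
      by (rule continuous_on_eq) (auto simp: L)
  qed
  have int: "(\<lambda>t. f (x, t)) integrable_on cbox p q" if "x \<in> \<Omega>" for x
    using that by (intro integrable_continuous continuous_on_compose2[OF cf] continuous_intros) auto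
  have intL: "L x integrable_on cbox p q" if "x \<in> \<Omega>" for x
  proof -
    have "continuous_on (cbox p q) (\<lambda>t. (x, t))" by (intro continuous_intros)
    from continuous_on_compose2[OF cL this] that have "continuous_on (cbox p q) (L x)" by auto
    then show ?thesis by (rule integrable_continuous)
  qed
  have D: "((\<lambda>x. integral (cbox p q) (\<lambda>t. f (x, t))) has_derivative
      blinfun_apply (integral (cbox p q) (L x))) (at x)" if x: "x \<in> \<Omega>" for x
  proof -
    \<comment> \<open>The Leibniz rule is stated on a convex parameter set, so it is applied on a
      ball around \<open>x\<close>; openness of the ball then removes the restriction.\<close>
    obtain r where r: "r > 0" "ball x r \<subseteq> \<Omega>" using \<Omega> x openE by blast
    have "((\<lambda>x. integral (cbox p q) (\<lambda>t. f (x, t))) has_derivative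
      blinfun_apply (integral (cbox p q) (L x))) (at x within ball x r)"
    proof (rule leibniz_rule)
      fix y t assume "y \<in> ball x r"
      then have "y \<in> \<Omega>" using r by auto
      then show "((\<lambda>x. f (x, t)) has_derivative blinfun_apply (L y t)) (at y within ball x r)"
        using slice has_derivative_at_withinI by (simp add: L) blast
    next
      show "continuous_on (ball x r \<times> cbox p q) (\<lambda>(x, t). L x t)"
        using r by (intro continuous_on_subset[OF cL]) auto
    qed (use r int in auto)
    then show ?thesis using r by (simp add: at_within_open[of x "ball x r"])
  qed
  have E: "blinfun_apply (integral (cbox p q) (L x)) v = integral (cbox p q) (\<lambda>t. dirD (v, 0) f (x, t))"
    if "x \<in> \<Omega>" for x v
    unfolding blinfun_apply_integral[OF intL[OF that]] L[OF that] ..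
  show "x \<in> \<Omega> \<Longrightarrow> v \<in> Basis \<Longrightarrow> dirD v (\<lambda>x. integral {p..q} (\<lambda>t. f (x, t))) x
      = integral {p..q} (\<lambda>t. dirD (v, 0) f (x, t))"
    using dirD_eq[OF D] E by simp
  have "continuous_on \<Omega> (\<lambda>x. blinfun_apply (integral (cbox p q) (L x)) b)" if "b \<in> Basis" for b
  proof (rule continuous_on_eq)
    show "continuous_on \<Omega> (\<lambda>x. integral (cbox p q) (\<lambda>t. dirD (b, 0) f (x, t)))"
      using continuous_on_subset[OF cD[OF that], of "\<Omega> \<times> cbox p q"]
      by (intro integral_continuous_on_param) (auto simp: case_prod_beta)
  qed (rule E[symmetric])
  then have "Ck (Suc 0) \<Omega> (\<lambda>x. integral (cbox p q) (\<lambda>t. f (x, t)))"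
    by (intro Ck_SucI[OF \<Omega> D]) simp_all
  then show "Ck 1 \<Omega> (\<lambda>x. integral {p..q} (\<lambda>t. f (x, t)))" by simp
qed

theorem poincare_contractible:
  fixes \<Omega> :: "(real ^ ('n::{finite,linorder})) set"
  assumes \<Omega>: "open \<Omega>" "contractible \<Omega>" and k: "1 \<le> k" and \<omega>: "k_form \<Omega> k \<omega>" "Ck 1 \<Omega> \<omega>"
    and closed: "\<And>x. x \<in> \<Omega> \<Longrightarrow> ext_d \<omega> x = 0"
  obtains u where "k_form \<Omega> (k - 1) u" "Ck 1 \<Omega> u" "\<And>x. x \<in> \<Omega> \<Longrightarrow> ext_d u x = \<omega> x"
proof -
  obtain a and H :: "'n cyl \<Rightarrow> 'n pt" where H: "Ck 2 (\<Omega> \<times> UNIV) H"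
    "\<And>x t. x \<in> \<Omega> \<Longrightarrow> H (x, t) \<in> \<Omega>"
    "\<And>x t. x \<in> \<Omega> \<Longrightarrow> t \<le> -1 \<Longrightarrow> H (x, t) = a" "\<And>x t. x \<in> \<Omega> \<Longrightarrow> 2 \<le> t \<Longrightarrow> H (x, t) = x"
    by (rule contractible_smooth_homotopy[OF \<Omega>, of 2]) (rule that; assumption)
  define M where "M = \<Omega> \<times> (UNIV :: real set)"
  have M: "open M" using \<Omega>(1) by (simp add: M_def open_Times)
  have HM: "Ck 2 M H" "H ` M \<subseteq> \<Omega>" using H(1,2) by (auto simp: M_def)
  \<comment> \<open>The interval strictly contains \<open>[-1, 2]\<close>: \<open>cyl_form\<close>
    involves derivatives of \<open>H\<close>, so at each end \<open>H\<close> must be constant or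
    the identity on a neighbourhood, not just at that time.\<close>
  define u where "u = (\<lambda>x. integral {-2..3} (\<lambda>t. cyl_dt_form H \<omega> (x, t)))"
  note CF = Ck_cyl_form[OF M HM \<omega>(2)]
  have \<kappa>: "Ck 1 (\<Omega> \<times> UNIV) (cyl_dt_form H \<omega>)" using CF(2) by (simp add: M_def)
  have c\<kappa>: "continuous_on (\<Omega> \<times> UNIV) (cyl_dt_form H \<omega>)" using \<kappa> by (rule Ck_imp_continuous_on)
  have int: "(\<lambda>t. cyl_dt_form H \<omega> (x, t)) integrable_on {-2..3}" if "x \<in> \<Omega>" for x
    using that by (intro integrable_continuous_real continuous_on_compose2[OF c\<kappa>] continuous_intros) auto
  have covecs: "cyl_dt_form H \<omega> z \<in> covecs (k - 1)" if "z \<in> M" for z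
    unfolding cyl_dt_form_def
  proof (intro subspace_sum subspace_covecs)
    fix J :: "'n set"
    have "H z \<in> \<Omega>" using HM(2) that by auto
    then have "card J \<noteq> k \<Longrightarrow> \<omega> (H z) $ J = 0" using \<omega>(1) by (simp add: k_form_def covecs_def)
    then show "(\<omega> (H z) $ J) *\<^sub>R snd (cyl_word H (sorted_list_of_set J) z) \<in> covecs (k - 1)"
      using covecs_cyl_word[of H "sorted_list_of_set J" z]
      by (cases "card J = k") (auto intro: subspace_scale[OF subspace_covecs] simp: subspace_0[OF subspace_covecs])
  qed
  have "k_form \<Omega> (k - 1) u"
    unfolding k_form_def covecs_def
  proof safe
    fix x :: "'n pt" and J :: "'n set" assume x: "x \<in> \<Omega>" and J: "card J \<noteq> k - 1"
    have "(x, t) \<in> M" for t using x by (simp add: M_def)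
    then have 0: "cyl_dt_form H \<omega> (x, t) $ J = 0" for t
      using covecs[of "(x, t)"] J by (simp add: covecs_def)
    show "u x $ J = 0"
      unfolding u_def integral_component_eq_cart[OF int[OF x], symmetric] 0 by simp
  qed
  moreover have "Ck 1 \<Omega> u" unfolding u_def by (rule Ck_integral_cylinder(1)[OF \<Omega>(1) \<kappa>])
  moreover have "ext_d u x = \<omega> x" if x: "x \<in> \<Omega>" for x
  proof -
    have xM: "(x, t) \<in> M" for t using x by (simp add: M_def)
    have cD: "continuous_on {-2..3} (\<lambda>t. dirD (sp_dir i) (cyl_dt_form H \<omega>) (x, t))" for i
    proof -
      have "Ck (Suc 0) (\<Omega> \<times> UNIV) (cyl_dt_form H \<omega>)" using \<kappa> by simp
      from Ck_SucD(2)[OF this sp_dir_tm_dir_Basis(1)]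
      have c: "continuous_on (\<Omega> \<times> UNIV) (dirD (sp_dir i) (cyl_dt_form H \<omega>))" by simp
      show ?thesis
        by (rule continuous_on_compose2[OF c]) (use x in \<open>auto intro!: continuous_intros\<close>)
    qed
    have di: "dx i \<and>\<^sub>w dirD (axis i 1) u x = integral {-2..3} (\<lambda>t. dx i \<and>\<^sub>w dirD (sp_dir i) (cyl_dt_form H \<omega>) (x, t))" for i
    proof -
      have "dirD (axis i 1) u x = integral {-2..3} (\<lambda>t. dirD (sp_dir i) (cyl_dt_form H \<omega>) (x, t))"
        unfolding u_def sp_dir_def
        by (rule Ck_integral_cylinder(2)[OF \<Omega>(1) \<kappa> x]) (auto simp: Basis_vec_def)
      then show ?thesis
        using integral_linear[OF integrable_continuous_real[OF cD[of i]] bounded_linear_wedge[of "dx i"]] by (simp add: o_def)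
    qed
    have "ext_d u x = integral {-2..3} (\<lambda>t. sp_d (cyl_dt_form H \<omega>) (x, t))"
      unfolding ext_d_dirD di sp_d_def
      by (rule integral_sum[symmetric])
        (auto intro!: integrable_continuous_real bounded_linear.continuous_on[OF bounded_linear_wedge] cD)
    also have "\<dots> = integral {-2..3} (\<lambda>t. dirD tm_dir (cyl_form H \<omega>) (x, t))"
      using cyl_form_closed[OF M xM HM \<omega>(2) closed] H(2) x by simp
    also have "\<dots> = cyl_form H \<omega> (x, 3) - cyl_form H \<omega> (x, -2)"
    proof (intro integral_unique fundamental_theorem_of_calculus)
      fix t :: real
      have "cyl_form H \<omega> differentiable at (x, t)" using CF(1) xM by auto
      note d = dirD_works[OF this]
      have "((\<lambda>t. (x, t)) has_derivative (\<lambda>s. (0, s))) (at t)"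
        by (auto intro!: derivative_eq_intros)
      from diff_chain_at[OF this d]
      have "((\<lambda>t. cyl_form H \<omega> (x, t)) has_derivative (\<lambda>s. dirD (s *\<^sub>R tm_dir) (cyl_form H \<omega>) (x, t))) (at t)"
        by (simp add: o_def tm_dir_def)
      then have "((\<lambda>t. cyl_form H \<omega> (x, t)) has_vector_derivative dirD tm_dir (cyl_form H \<omega>) (x, t)) (at t)"
        unfolding has_vector_derivative_def linear_scale[OF has_derivative_linear[OF d]] .
      then show "((\<lambda>t. cyl_form H \<omega> (x, t)) has_vector_derivative dirD tm_dir (cyl_form H \<omega>) (x, t))
          (at t within {-2..3})"
        by (rule has_vector_derivative_at_within)
    qed simp
    also have "cyl_form H \<omega> (x, 3) = \<omega> x"
    proof -
      have o: "open (\<Omega> \<times> {2::real<..})" "(x, 3) \<in> \<Omega> \<times> {2::real<..}"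
        using \<Omega>(1) x by (simp_all add: open_Times)
      have "H y = fst y" if "y \<in> \<Omega> \<times> {2<..}" for y
        using that H(4)[of "fst y" "snd y"] by (simp add: mem_Times_iff)
      from cyl_form_id[OF o this, of \<omega>] show ?thesis by simp
    qed
    also have "cyl_form H \<omega> (x, -2) = 0"
    proof (rule cyl_form_const[of "\<Omega> \<times> {..<-1}" _ _ a])
      \<comment> \<open>The domain is not empty here, and the point \<open>a\<close> is a value of
        \<open>H\<close>; \<open>k \<ge> 1\<close> kills the coefficient at
        \<open>{}\<close>.\<close>
      have "a \<in> \<Omega>" using H(2,3)[OF x, of "-1"] by simp
      then show "\<omega> a $ {} = 0" using \<omega>(1) k by (simp add: k_form_def covecs_def)
    next
      show "H y = a" if "y \<in> \<Omega> \<times> {..<-1}" for y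
        using that H(3)[of "fst y" "snd y"] by (simp add: mem_Times_iff)
    qed (use \<Omega>(1) x in \<open>simp_all add: open_Times\<close>)
    finally show ?thesis by simp
  qed
  ultimately show thesis by (rule that)
qed

subsection \<open>Conjugate harmonic forms\<close>

lemma covecs_dirD:
  assumes "open \<Omega>" "k_form \<Omega> k \<omega>" "x \<in> \<Omega>" "\<omega> differentiable at x"
  shows "dirD v \<omega> x \<in> covecs k"
  unfolding covecs_def
proof safe
  fix J :: "'a set" assume J: "card J \<noteq> k"
  have "dirD v \<omega> x $ J = dirD v (\<lambda>y. \<omega> y $ J) x"
    by (rule dirD_eq[symmetric])
      (rule bounded_linear.has_derivative[OF bounded_linear_vec_nth dirD_works[OF assms(4)]])
  also have "\<dots> = dirD v (\<lambda>_. 0) x"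
    using assms(2) J by (intro dirD_cong[OF assms(1,3)]) (simp add: k_form_def covecs_def)
  finally show "dirD v \<omega> x $ J = 0" by (simp add: dirD_const)
qed

lemma k_form_ext_d:
  assumes "open \<Omega>" "k_form \<Omega> k \<omega>" "Ck 1 \<Omega> \<omega>"
  shows "k_form \<Omega> (Suc k) (ext_d \<omega>)"
  unfolding k_form_def ext_d_dirD[abs_def]
  using assms by (auto intro!: subspace_sum[OF subspace_covecs] covecs_wedge_dx covecs_dirD)

lemma form_norm2_inner: "form_norm2 a = a \<bullet> a"
  by (simp add: form_norm2_def form_inner)

text \<open>At \<open>a = 0\<close> only a one-sided derivative of \<open>\<rho>\<close> is
  available. The chain rule still applies within the range of \<open>a \<bullet> a\<close>, which
  lies in \<open>{0..}\<close>.\<close>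

lemma Ck_C1_halfline_inner:
  fixes \<rho> :: "real \<Rightarrow> real"
  assumes "C1_halfline \<rho>"
  shows "Ck 1 UNIV (\<lambda>a::'a::euclidean_space. \<rho> (a \<bullet> a))"
proof -
  obtain \<rho>' where \<rho>': "continuous_on {0..} \<rho>'"
    "\<And>t. 0 \<le> t \<Longrightarrow> (\<rho> has_real_derivative \<rho>' t) (at t within {0..})"
    using assms unfolding C1_halfline_def by auto
  have d: "((\<lambda>a. \<rho> (a \<bullet> a)) has_derivative (\<lambda>h. \<rho>' (a \<bullet> a) * (a \<bullet> h + h \<bullet> a))) (at a)" for a :: 'a
  proof -
    have 1: "((\<lambda>a::'a. a \<bullet> a) has_derivative (\<lambda>h. a \<bullet> h + h \<bullet> a)) (at a)"
      by (auto intro!: derivative_eq_intros)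
    have "(\<rho> has_derivative (\<lambda>t. \<rho>' (a \<bullet> a) * t)) (at (a \<bullet> a) within {0..})"
      using \<rho>'(2)[of "a \<bullet> a"] by (simp add: has_field_derivative_def)
    then have "(\<rho> has_derivative (\<lambda>t. \<rho>' (a \<bullet> a) * t)) (at (a \<bullet> a) within range (\<lambda>a::'a. a \<bullet> a))"
      by (rule has_derivative_subset) auto
    from has_derivative_in_compose[OF 1 this] show ?thesis .
  qed
  have "continuous_on UNIV (\<lambda>a::'a. \<rho>' (a \<bullet> a) * (a \<bullet> b + b \<bullet> a))" for b
    by (intro continuous_intros continuous_on_compose2[OF \<rho>'(1)]) auto
  then have "Ck (Suc 0) UNIV (\<lambda>a::'a. \<rho> (a \<bullet> a))"
    by (intro Ck_SucI[OF open_UNIV d]) simp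
  then show ?thesis by simp
qed

lemma ext_d_ln_wedge:
  assumes "g differentiable at x" "0 < g x"
  shows "ext_d (zero_form (\<lambda>y. ln (g y))) x \<and>\<^sub>w (g x *\<^sub>R a) = ext_d (zero_form g) x \<and>\<^sub>w a"
proof -
  have "((\<lambda>y. ln (g y)) has_derivative (\<lambda>v. dirD v g x * inverse (g x))) (at x)"
    by (rule has_derivative_ln[OF assms(2) dirD_works[OF assms(1)]])
  moreover from this have "(\<lambda>y. ln (g y)) differentiable at x"
    unfolding differentiable_def by blast
  moreover have c: "g x * (d * inverse (g x)) = d" for d using assms(2) by simp
  ultimately show ?thesis
    using assms(1) by (simp add: ext_d_zero_form_wedge dirD_eq wedge_linear_simps scaleR_sum_right c)
qed

text \<open>Writing \<open>\<eta> = g \<omega>\<close>, the equation \<open>d\<eta> = d(ln g) \<and> \<eta>\<close> says \<open>g d\<omega> = 0\<close>.\<close>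

lemma ext_d_eq_ln_wedge_iff:
  assumes \<Omega>: "open \<Omega>" "x \<in> \<Omega>" and g: "g differentiable at x" "0 < g x" and \<omega>: "\<omega> differentiable at x"
    and \<eta>: "\<And>y. y \<in> \<Omega> \<Longrightarrow> \<eta> y = g y *\<^sub>R \<omega> y"
  shows "ext_d \<eta> x = ext_d (zero_form (\<lambda>y. ln (g y))) x \<and>\<^sub>w \<eta> x \<longleftrightarrow> ext_d \<omega> x = 0"
proof -
  have "ext_d \<eta> x = ext_d (zero_form g) x \<and>\<^sub>w \<omega> x + g x *\<^sub>R ext_d \<omega> x"
    using ext_d_cong[OF \<Omega> \<eta>] ext_d_scaleR[OF g(1) \<omega>] by simp
  then show ?thesis
    using g(2) by (simp add: \<eta>[OF \<Omega>(2)] ext_d_ln_wedge[OF g])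
qed

text \<open>The dual Poincare lemma: \<open>dual_star_inv\<close> turns a coclosed form of degree
  \<open>k\<close> into a closed one of degree \<open>CARD('n) - k\<close>, which is positive
  because \<open>k < CARD('n)\<close>.\<close>

lemma coclosed_form_potential:
  fixes \<Omega> :: "(real ^ ('n::{finite,linorder})) set"
  assumes \<Omega>: "open \<Omega>" "contractible \<Omega>" and k: "k < CARD('n)" and \<eta>: "k_form \<Omega> k \<eta>" "Ck 1 \<Omega> \<eta>"
    and coclosed: "\<And>x. x \<in> \<Omega> \<Longrightarrow> codiff \<eta> x = 0"
  obtains v where "k_form \<Omega> (k + 1) v" "Ck 1 \<Omega> v" "\<And>x. x \<in> \<Omega> \<Longrightarrow> codiff v x = \<eta> x"
proof -
  define \<zeta> where "\<zeta> = (\<lambda>x. dual_star_inv (\<eta> x))"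
  have \<zeta>: "Ck 1 \<Omega> \<zeta>" unfolding \<zeta>_def by (rule Ck_linear_comp[OF bounded_linear_dual_star(2) \<Omega>(1) \<eta>(2)])
  have d\<zeta>: "\<zeta> differentiable at x" "\<eta> differentiable at x" if "x \<in> \<Omega>" for x
    using \<zeta> \<eta>(2) that by auto
  \<comment> \<open>The sign chosen here cancels the minus in
    \<open>codiff_dual_star\<close>.\<close>
  have k\<zeta>: "k_form \<Omega> (CARD('n) - k) (\<lambda>x. - \<zeta> x)"
    using \<eta>(1) k by (auto simp: k_form_def \<zeta>_def intro!: subspace_neg[OF subspace_covecs] covecs_dual_star(2))
  have c\<zeta>: "ext_d (\<lambda>x. - \<zeta> x) x = 0" if x: "x \<in> \<Omega>" for x
  proof -
    have "dual_star (ext_d \<zeta> x) = 0"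
      using codiff_eq_dual_star[OF d\<zeta>(2)[OF x]] coclosed[OF x] by (simp add: \<zeta>_def)
    then have "dual_star_inv (dual_star (ext_d \<zeta> x)) = 0"
      by (simp add: linear_0[OF bounded_linear.linear[OF bounded_linear_dual_star(2)]])
    then show ?thesis by (simp add: dual_star_inv ext_d_minus[OF d\<zeta>(1)[OF x]])
  qed
  have "Ck 1 \<Omega> (\<lambda>x. - \<zeta> x)"
    by (rule Ck_linear_comp[OF bounded_linear_minus[OF bounded_linear_ident] \<Omega>(1) \<zeta>])
  moreover have "1 \<le> CARD('n) - k" using k by simp
  ultimately obtain w where w: "k_form \<Omega> (CARD('n) - k - 1) w" "Ck 1 \<Omega> w"
    "\<And>x. x \<in> \<Omega> \<Longrightarrow> ext_d w x = - \<zeta> x"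
    using poincare_contractible[OF \<Omega> _ k\<zeta> _ c\<zeta>] by metis
  show thesis
  proof (rule that[of "\<lambda>x. dual_star (w x)"])
    have "CARD('n) - (CARD('n) - k - 1) = k + 1" using k by simp
    then show "k_form \<Omega> (k + 1) (\<lambda>x. dual_star (w x))"
      using w(1) covecs_dual_star(1)[of "w _" "CARD('n) - k - 1"] by (simp add: k_form_def)
    show "Ck 1 \<Omega> (\<lambda>x. dual_star (w x))"
      by (rule Ck_linear_comp[OF bounded_linear_dual_star(1) \<Omega>(1) w(2)])
    fix x assume x: "x \<in> \<Omega>"
    have "w differentiable at x" using w(2) x by auto
    then show "codiff (\<lambda>x. dual_star (w x)) x = \<eta> x"
      by (simp add: codiff_dual_star w(3)[OF x] \<zeta>_def dual_star_inv
          linear_neg[OF bounded_linear.linear[OF bounded_linear_dual_star(1)]])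
  qed
qed

theorem proposition2p1:
  fixes \<Omega> :: "(real ^ ('n::{finite,linorder})) set"
    and k :: nat
    and \<rho> :: "real \<Rightarrow> real"
    and B :: "'n form \<Rightarrow> 'n form"
  assumes "smooth_domain \<Omega>"
    and "1 \<le> k" and "k \<le> CARD('n) - 1"
    and "\<forall>t\<ge>0. \<rho> t > 0" and "C1_halfline \<rho>"
    and "pointwise_inverse \<Omega> k (A_op \<rho>) B"
  shows
    "(\<forall>u v. k_form \<Omega> (k - 1) u \<and> C_on 2 \<Omega> u \<and> k_form \<Omega> (k + 1) v \<and> C_on 2 \<Omega> v \<and>
        conjugate_harmonic \<Omega> (A_op \<rho>) u v \<longrightarrow>
        k_form \<Omega> k (codiff v) \<and> C_on 1 \<Omega> (codiff v) \<and>
        C_on 1 \<Omega> (\<lambda>x. \<rho> (form_norm2 (B (codiff v) x))) \<and>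
        (\<forall>x\<in>\<Omega>. codiff (codiff v) x = 0 \<and>
               ext_d (codiff v) x = Gamma_form \<rho> B (codiff v) x \<and>\<^sub>w codiff v x))
   \<and> (\<forall>\<eta>. k_form \<Omega> k \<eta> \<and> C_on 1 \<Omega> \<eta> \<and> C_on 1 \<Omega> (\<lambda>x. \<rho> (form_norm2 (B \<eta> x))) \<and>
        (\<forall>x\<in>\<Omega>. codiff \<eta> x = 0 \<and> ext_d \<eta> x = Gamma_form \<rho> B \<eta> x \<and>\<^sub>w \<eta> x) \<longrightarrow>
        k_form \<Omega> k (B \<eta>) \<and> C_on 1 \<Omega> (B \<eta>) \<and>
        (\<forall>x\<in>\<Omega>. codiff (\<lambda>y. \<rho> (form_norm2 (B \<eta> y)) *\<^sub>R B \<eta> y) x = 0 \<and> ext_d (B \<eta>) x = 0))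
   \<and> (\<forall>\<eta>. k_form \<Omega> k \<eta> \<and> C_on 1 \<Omega> \<eta> \<and> C_on 1 \<Omega> (\<lambda>x. \<rho> (form_norm2 (B \<eta> x))) \<and>
        (\<forall>x\<in>\<Omega>. codiff \<eta> x = 0 \<and> ext_d \<eta> x = Gamma_form \<rho> B \<eta> x \<and>\<^sub>w \<eta> x) \<and> contractible \<Omega> \<longrightarrow>
        (\<exists>u v. k_form \<Omega> (k - 1) u \<and> C_on 1 \<Omega> u \<and> k_form \<Omega> (k + 1) v \<and> C_on 1 \<Omega> v \<and>
           conjugate_harmonic \<Omega> (A_op \<rho>) u v \<and>
           (\<forall>x\<in>\<Omega>. B \<eta> x = ext_d u x \<and> \<eta> x = codiff v x)))"
proof -
  have \<Omega>: "open \<Omega>" using assms(1) by (simp add: smooth_domain_def)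
  \<comment> \<open>Forms are total functions, and \<open>codiff v\<close> agrees with
    \<open>A_op \<rho> (ext_d u)\<close> only on \<open>\<Omega>\<close>. The fibre map
    \<open>b\<close> shows that \<open>B\<close> takes the same values on \<open>\<Omega>\<close>
    for both.\<close>
  obtain b where b: "\<And>\<omega> x. k_form \<Omega> k \<omega> \<Longrightarrow> x \<in> \<Omega> \<Longrightarrow> B \<omega> x = b x (\<omega> x)"
    using assms(6) unfolding pointwise_inverse_def by blast
  have B: "k_form \<Omega> k (B \<omega>)" "\<And>x. x \<in> \<Omega> \<Longrightarrow> B (A_op \<rho> \<omega>) x = \<omega> x"
    "\<And>x. x \<in> \<Omega> \<Longrightarrow> A_op \<rho> (B \<omega>) x = \<omega> x" if "k_form \<Omega> k \<omega>" for \<omega>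
    using assms(6) that unfolding pointwise_inverse_def by blast+
  have pos: "0 < \<rho> (form_norm2 a)" for a :: "'n covec"
    using assms(4) by (simp add: form_norm2_inner)
  have k: "k < CARD('n)"
    using assms(2,3) by linarith
  have i: "k_form \<Omega> k (codiff v) \<and> Ck 1 \<Omega> (codiff v) \<and> Ck 1 \<Omega> (\<lambda>x. \<rho> (form_norm2 (B (codiff v) x))) \<and>
      (\<forall>x\<in>\<Omega>. codiff (codiff v) x = 0 \<and>
               ext_d (codiff v) x = Gamma_form \<rho> B (codiff v) x \<and>\<^sub>w codiff v x)"
    if u: "k_form \<Omega> (k - 1) u" "Ck 2 \<Omega> u" and v: "Ck 2 \<Omega> v"
      and conj: "\<And>x. x \<in> \<Omega> \<Longrightarrow> A_op \<rho> (ext_d u) x = codiff v x" for u v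
  proof -
    have Suc: "Ck (Suc 1) \<Omega> u" "Ck (Suc 1) \<Omega> v" using u(2) v by (simp_all add: numeral_2_eq_2)
    have "k_form \<Omega> (Suc (k - 1)) (ext_d u)"
      by (rule k_form_ext_d[OF \<Omega> u(1) Ck_Suc_imp[OF Suc(1)]])
    then have kdu: "k_form \<Omega> k (ext_d u)" using assms(2) by simp
    then have kA: "k_form \<Omega> k (A_op \<rho> (ext_d u))"
      by (auto simp: k_form_def A_op_def intro!: subspace_scale[OF subspace_covecs])
    then have kv: "k_form \<Omega> k (codiff v)" using conj by (simp add: k_form_def)
    have du: "Ck 1 \<Omega> (ext_d u)" by (rule Ck_ext_d[OF \<Omega> Suc(1)])
    have Bv: "B (codiff v) x = ext_d u x" if "x \<in> \<Omega>" for x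
      using b[OF kv that] b[OF kA that] conj[OF that] B(2)[OF kdu that] by simp
    let ?f = "\<lambda>x. \<rho> (form_norm2 (B (codiff v) x))"
    \<comment> \<open>In this direction regularity comes from \<open>u\<close>:
      \<open>B (codiff v)\<close> is \<open>ext_d u\<close> on \<open>\<Omega>\<close>, which is C^1
      since \<open>u\<close> is C^2.\<close>
    have "Ck 1 \<Omega> (\<lambda>x. \<rho> (ext_d u x \<bullet> ext_d u x))"
      by (rule Ck_compose[OF \<Omega> subset_UNIV du Ck_C1_halfline_inner[OF assms(5)]])
    then have f: "Ck 1 \<Omega> ?f"
      using Ck_cong[OF \<Omega>, of ?f "\<lambda>x. \<rho> (ext_d u x \<bullet> ext_d u x)" 1] Bv by (simp only: form_norm2_inner)
    have cv: "codiff v x = ?f x *\<^sub>R ext_d u x" if "x \<in> \<Omega>" for x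
      using conj[OF that] Bv[OF that] by (simp add: A_op_def)
    have "ext_d (codiff v) x = Gamma_form \<rho> B (codiff v) x \<and>\<^sub>w codiff v x" if x: "x \<in> \<Omega>" for x
    proof -
      have fx: "?f differentiable at x" "ext_d u differentiable at x"
        using f du x by auto
      show ?thesis
        using ext_d_eq_ln_wedge_iff[OF \<Omega> x fx(1) pos fx(2) cv] ext_d_ext_d[OF \<Omega> x u(2)]
        unfolding Gamma_form_def by blast
    qed
    then show ?thesis
      using kv f Ck_codiff[OF \<Omega> Suc(2)] codiff_codiff[OF \<Omega> _ v] by blast
  qed
  have ii: "k_form \<Omega> k (B \<eta>) \<and> Ck 1 \<Omega> (B \<eta>) \<and>
      (\<forall>x\<in>\<Omega>. codiff (\<lambda>y. \<rho> (form_norm2 (B \<eta> y)) *\<^sub>R B \<eta> y) x = 0 \<and> ext_d (B \<eta>) x = 0)"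
    if \<eta>: "k_form \<Omega> k \<eta>" "Ck 1 \<Omega> \<eta>" and f: "Ck 1 \<Omega> (\<lambda>x. \<rho> (form_norm2 (B \<eta> x)))"
      and eq: "\<And>x. x \<in> \<Omega> \<Longrightarrow> codiff \<eta> x = 0"
        "\<And>x. x \<in> \<Omega> \<Longrightarrow> ext_d \<eta> x = Gamma_form \<rho> B \<eta> x \<and>\<^sub>w \<eta> x" for \<eta>
  proof -
    let ?f = "\<lambda>x. \<rho> (form_norm2 (B \<eta> x))"
    have A: "\<eta> x = ?f x *\<^sub>R B \<eta> x" if "x \<in> \<Omega>" for x
      using B(3)[OF \<eta>(1) that] by (simp add: A_op_def)
    \<comment> \<open>Dividing \<open>\<eta>\<close> by the C^1 function \<open>?f\<close> recovers
      \<open>B \<eta>\<close> and is the source of its differentiability.\<close>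
    have "?f x \<noteq> 0" for x using pos[of "B \<eta> x"] by simp
    then have "?f ` \<Omega> \<subseteq> {x. x \<noteq> 0}" by auto
    from Ck_bilinear[OF bounded_bilinear_scaleR \<Omega> Ck_compose[OF \<Omega> this f Ck_inverse] \<eta>(2)]
    have "Ck 1 \<Omega> (\<lambda>x. inverse (?f x) *\<^sub>R \<eta> x)" .
    moreover have "inverse (?f x) *\<^sub>R \<eta> x = B \<eta> x" if "x \<in> \<Omega>" for x
      using A[OF that] pos[of "B \<eta> x"] by simp
    ultimately have CB: "Ck 1 \<Omega> (B \<eta>)"
      using Ck_cong[OF \<Omega>, of "\<lambda>x. inverse (?f x) *\<^sub>R \<eta> x" "B \<eta>" 1] by blast
    have "ext_d (B \<eta>) x = 0" if x: "x \<in> \<Omega>" for x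
    proof -
      have fx: "?f differentiable at x" "B \<eta> differentiable at x" using f CB x by auto
      show ?thesis
        using ext_d_eq_ln_wedge_iff[OF \<Omega> x fx(1) pos fx(2) A] eq(2)[OF x]
        unfolding Gamma_form_def by blast
    qed
    moreover have "codiff (\<lambda>y. ?f y *\<^sub>R B \<eta> y) x = 0" if x: "x \<in> \<Omega>" for x
      using codiff_cong[OF \<Omega> x A] eq(1)[OF x] by simp
    ultimately show ?thesis using B(1)[OF \<eta>(1)] CB by blast
  qed
  have iii: "\<exists>u v. k_form \<Omega> (k - 1) u \<and> Ck 1 \<Omega> u \<and> k_form \<Omega> (k + 1) v \<and> Ck 1 \<Omega> v \<and>
      conjugate_harmonic \<Omega> (A_op \<rho>) u v \<and> (\<forall>x\<in>\<Omega>. B \<eta> x = ext_d u x \<and> \<eta> x = codiff v x)"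
    if \<eta>: "k_form \<Omega> k \<eta>" "Ck 1 \<Omega> \<eta>" and co: "\<And>x. x \<in> \<Omega> \<Longrightarrow> codiff \<eta> x = 0"
      and B\<eta>: "Ck 1 \<Omega> (B \<eta>)" "\<And>x. x \<in> \<Omega> \<Longrightarrow> ext_d (B \<eta>) x = 0" and ctr: "contractible \<Omega>" for \<eta>
  proof -
    obtain u where u: "k_form \<Omega> (k - 1) u" "Ck 1 \<Omega> u" "\<And>x. x \<in> \<Omega> \<Longrightarrow> ext_d u x = B \<eta> x"
      by (rule poincare_contractible[OF \<Omega> ctr assms(2) B(1)[OF \<eta>(1)] B\<eta>]) (assumption | (rule that; assumption))+
    obtain v where v: "k_form \<Omega> (k + 1) v" "Ck 1 \<Omega> v" "\<And>x. x \<in> \<Omega> \<Longrightarrow> codiff v x = \<eta> x"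
      by (rule coclosed_form_potential[OF \<Omega> ctr k \<eta> co]) (assumption | (rule that; assumption))+
    \<comment> \<open>The two potentials are found independently; they are linked only through
      \<open>A_op \<rho> (B \<eta>) = \<eta>\<close> on \<open>\<Omega>\<close>.\<close>
    have "conjugate_harmonic \<Omega> (A_op \<rho>) u v"
      unfolding conjugate_harmonic_def
      using B(3)[OF \<eta>(1)] u(3) v(3) by (simp add: A_op_def)
    then show ?thesis using u v by metis
  qed
  show ?thesis
    unfolding C_on_eq_Ck
  proof (intro conjI, goal_cases)
    case 1
    show ?case using i unfolding conjugate_harmonic_def by blast
  next
    case 2
    show ?case
    proof (intro allI impI, elim conjE, goal_cases)
      case (1 \<eta>)
      show ?case by (rule ii) (use 1 in blast)+
    qed
  next
    case 3
    show ?case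
    proof (intro allI impI, elim conjE, goal_cases)
      case (1 \<eta>)
      have "Ck 1 \<Omega> (B \<eta>) \<and> (\<forall>x\<in>\<Omega>. ext_d (B \<eta>) x = 0)"
        using ii[of \<eta>] 1 by blast
      with 1 show ?case by (intro iii) blast+
    qed
  qed
qed

end
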